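(* Let $\mathcal{A}$ be an abelian category, and let $L$, $M$, $\underline{K}$ be objects of the homotopy category $K(\mathcal{A})$ (i.e. cochain complexes in $\mathcal{A}$). Let $\alpha: L\rightarrow \underline{K}$ and $\beta: M\rightarrow \underline{K}$ be morphisms in $K(\mathcal{A})$ such that $\beta$ is a quasi-isomorphism. Then there exist a cochain complex $K$ in $\mathcal{A}$ and morphisms $\gamma_2: K\rightarrow L$ and $\gamma_1: K\rightarrow M$ in $K(\mathcal{A})$ such that $\gamma_2$ is a quasi-isomorphism and $\alpha\circ\gamma_2=\beta\circ\gamma_1$ in $K(\mathcal{A})$.
   Context: For an abelian category $\mathcal{A}$, $C(\mathcal{A})$ denotes the category of all ($\mathbb{Z}$-indexed, not necessarily bounded) cochain complexes in $\mathcal{A}$. A homotopy between two morphisms $f,g: A\rightarrow B$ of cochain complexes is a collection of morphisms $k^i: A^i\rightarrow B^{i-1}$ such that $g^i-f^i=d_B^{i-1}\circ k^i+k^{i+1}\circ d_A^i$ for all $i$; one writes $f\sim g$ if such a homotopy exists. The homotopy category $K(\mathcal{A})$ has the same objects as $C(\mathcal{A})$, and $\mathrm{Hom}_{K(\mathcal{A})}(A,B)=\mathrm{Hom}_{C(\mathcal{A})}(A,B)/\sim$. A morphism of cochain complexes is a quasi-isomorphism if it induces an isomorphism in cohomology; since homotopic morphisms induce the same map in cohomology, this notion makes sense for morphisms in $K(\mathcal{A})$. *)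

theory Defs
  imports "HOL-Algebra.Group"
begin

section \<open>Categories\<close>

record ('o, 'm) category =
  Obj :: "'o set"
  Arr :: "'m set"
  Dom :: "'m \<Rightarrow> 'o"
  Cod :: "'m \<Rightarrow> 'o"
  Id :: "'o \<Rightarrow> 'm"
  Comp :: "'m \<Rightarrow> 'm \<Rightarrow> 'm"  (infixl "\<cdot>\<index>" 70)

definition Hom :: "('o, 'm, 'x) category_scheme \<Rightarrow> 'o \<Rightarrow> 'o \<Rightarrow> 'm set" where
  "Hom C a b = {f \<in> Arr C. Dom C f = a \<and> Cod C f = b}"

locale category =
  fixes C :: "('o, 'm, 'x) category_scheme" (structure)
  assumes Dom_closed: "f \<in> Arr C \<Longrightarrow> Dom C f \<in> Obj C"
    and Cod_closed: "f \<in> Arr C \<Longrightarrow> Cod C f \<in> Obj C"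
    and Id_Hom: "a \<in> Obj C \<Longrightarrow> Id C a \<in> Hom C a a"
    and Comp_Hom: "\<lbrakk>g \<in> Hom C b c; f \<in> Hom C a b\<rbrakk> \<Longrightarrow> g \<cdot> f \<in> Hom C a c"
    and Comp_assoc:
      "\<lbrakk>h \<in> Hom C c d; g \<in> Hom C b c; f \<in> Hom C a b\<rbrakk> \<Longrightarrow> (h \<cdot> g) \<cdot> f = h \<cdot> (g \<cdot> f)"
    and Comp_Id: "f \<in> Hom C a b \<Longrightarrow> f \<cdot> Id C a = f"
    and Id_Comp: "f \<in> Hom C a b \<Longrightarrow> Id C b \<cdot> f = f"

definition is_iso :: "('o, 'm, 'x) category_scheme \<Rightarrow> 'm \<Rightarrow> bool" where
  "is_iso C f \<longleftrightarrow> f \<in> Arr C \<and>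
     (\<exists>g \<in> Hom C (Cod C f) (Dom C f).
        g \<cdot>\<^bsub>C\<^esub> f = Id C (Dom C f) \<and> f \<cdot>\<^bsub>C\<^esub> g = Id C (Cod C f))"

definition is_mono :: "('o, 'm, 'x) category_scheme \<Rightarrow> 'm \<Rightarrow> bool" where
  "is_mono C f \<longleftrightarrow> f \<in> Arr C \<and>
     (\<forall>a. \<forall>g \<in> Hom C a (Dom C f). \<forall>h \<in> Hom C a (Dom C f). f \<cdot>\<^bsub>C\<^esub> g = f \<cdot>\<^bsub>C\<^esub> h \<longrightarrow> g = h)"

definition is_epi :: "('o, 'm, 'x) category_scheme \<Rightarrow> 'm \<Rightarrow> bool" where
  "is_epi C f \<longleftrightarrow> f \<in> Arr C \<and>
     (\<forall>b. \<forall>g \<in> Hom C (Cod C f) b. \<forall>h \<in> Hom C (Cod C f) b. g \<cdot>\<^bsub>C\<^esub> f = h \<cdot>\<^bsub>C\<^esub> f \<longrightarrow> g = h)"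

definition is_zero_object :: "('o, 'm, 'x) category_scheme \<Rightarrow> 'o \<Rightarrow> bool" where
  "is_zero_object C z \<longleftrightarrow> z \<in> Obj C \<and>
     (\<forall>a \<in> Obj C. (\<exists>!f. f \<in> Hom C z a) \<and> (\<exists>!f. f \<in> Hom C a z))"

definition is_product ::
  "('o, 'm, 'x) category_scheme \<Rightarrow> 'o \<Rightarrow> 'o \<Rightarrow> 'o \<Rightarrow> 'm \<Rightarrow> 'm \<Rightarrow> bool" where
  "is_product C a b p p1 p2 \<longleftrightarrow> p \<in> Obj C \<and> p1 \<in> Hom C p a \<and> p2 \<in> Hom C p b \<and>
     (\<forall>x \<in> Obj C. \<forall>f \<in> Hom C x a. \<forall>g \<in> Hom C x b.
        \<exists>!u. u \<in> Hom C x p \<and> p1 \<cdot>\<^bsub>C\<^esub> u = f \<and> p2 \<cdot>\<^bsub>C\<^esub> u = g)"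


section \<open>Abelian categories\<close>

record ('o, 'm) preadditive_category = "('o, 'm) category" +
  Add :: "'m \<Rightarrow> 'm \<Rightarrow> 'm"
  Zero :: "'o \<Rightarrow> 'o \<Rightarrow> 'm"

definition hom_group ::
  "('o, 'm, 'x) preadditive_category_scheme \<Rightarrow> 'o \<Rightarrow> 'o \<Rightarrow> 'm monoid" where
  "hom_group C a b = \<lparr>carrier = Hom C a b, mult = Add C, one = Zero C a b\<rparr>"

definition Minus :: "('o, 'm, 'x) preadditive_category_scheme \<Rightarrow> 'm \<Rightarrow> 'm \<Rightarrow> 'm" where
  "Minus C f g = Add C f (inv\<^bsub>hom_group C (Dom C g) (Cod C g)\<^esub> g)"

locale preadditive_category = category C
  for C :: "('o, 'm, 'x) preadditive_category_scheme" (structure) +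
  assumes hom_comm_group:
      "\<lbrakk>a \<in> Obj C; b \<in> Obj C\<rbrakk> \<Longrightarrow> comm_group (hom_group C a b)"
    and Comp_Add: "\<lbrakk>h \<in> Hom C b c; f \<in> Hom C a b; g \<in> Hom C a b\<rbrakk> \<Longrightarrow>
      h \<cdot> Add C f g = Add C (h \<cdot> f) (h \<cdot> g)"
    and Add_Comp: "\<lbrakk>g \<in> Hom C b c; h \<in> Hom C b c; f \<in> Hom C a b\<rbrakk> \<Longrightarrow>
      Add C g h \<cdot> f = Add C (g \<cdot> f) (h \<cdot> f)"

definition is_kernel :: "('o, 'm, 'x) preadditive_category_scheme \<Rightarrow> 'm \<Rightarrow> 'm \<Rightarrow> bool" where
  "is_kernel C f k \<longleftrightarrow> f \<in> Arr C \<and> k \<in> Arr C \<and> Cod C k = Dom C f \<and>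
     f \<cdot>\<^bsub>C\<^esub> k = Zero C (Dom C k) (Cod C f) \<and>
     (\<forall>x. \<forall>h \<in> Hom C x (Dom C f). f \<cdot>\<^bsub>C\<^esub> h = Zero C x (Cod C f) \<longrightarrow>
        (\<exists>!u. u \<in> Hom C x (Dom C k) \<and> k \<cdot>\<^bsub>C\<^esub> u = h))"

definition is_cokernel :: "('o, 'm, 'x) preadditive_category_scheme \<Rightarrow> 'm \<Rightarrow> 'm \<Rightarrow> bool" where
  "is_cokernel C f q \<longleftrightarrow> f \<in> Arr C \<and> q \<in> Arr C \<and> Dom C q = Cod C f \<and>
     q \<cdot>\<^bsub>C\<^esub> f = Zero C (Dom C f) (Cod C q) \<and>
     (\<forall>x. \<forall>h \<in> Hom C (Cod C f) x. h \<cdot>\<^bsub>C\<^esub> f = Zero C (Dom C f) x \<longrightarrow>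
        (\<exists>!u. u \<in> Hom C (Cod C q) x \<and> u \<cdot>\<^bsub>C\<^esub> q = h))"

locale abelian_category = preadditive_category C
  for C :: "('o, 'm, 'x) preadditive_category_scheme" (structure) +
  assumes ex_zero_object: "\<exists>z. is_zero_object C z"
    and ex_product:
      "\<lbrakk>a \<in> Obj C; b \<in> Obj C\<rbrakk> \<Longrightarrow> \<exists>p p1 p2. is_product C a b p p1 p2"
    and ex_kernel: "f \<in> Arr C \<Longrightarrow> \<exists>k. is_kernel C f k"
    and ex_cokernel: "f \<in> Arr C \<Longrightarrow> \<exists>q. is_cokernel C f q"
    and mono_is_kernel: "is_mono C f \<Longrightarrow> \<exists>g. is_kernel C g f"
    and epi_is_cokernel: "is_epi C f \<Longrightarrow> \<exists>g. is_cokernel C g f"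

text \<open>Chosen kernels, cokernels and images; as usual the object \<open>Ker f\<close> comes with its
  inclusion, which is what is represented here (the object is the domain of the inclusion).
  The image is the kernel of the cokernel.\<close>

definition ker_arr :: "('o, 'm, 'x) preadditive_category_scheme \<Rightarrow> 'm \<Rightarrow> 'm" where
  "ker_arr C f = (SOME k. is_kernel C f k)"

definition coker_arr :: "('o, 'm, 'x) preadditive_category_scheme \<Rightarrow> 'm \<Rightarrow> 'm" where
  "coker_arr C f = (SOME q. is_cokernel C f q)"

definition im_arr :: "('o, 'm, 'x) preadditive_category_scheme \<Rightarrow> 'm \<Rightarrow> 'm" where
  "im_arr C f = ker_arr C (coker_arr C f)"

text \<open>The factorisation of \<open>h\<close> through a monomorphism \<open>k\<close>, respectively through an
  epimorphism \<open>q\<close>.\<close>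

definition lift_along :: "('o, 'm, 'x) category_scheme \<Rightarrow> 'm \<Rightarrow> 'm \<Rightarrow> 'm" where
  "lift_along C k h = (THE u. u \<in> Hom C (Dom C h) (Dom C k) \<and> k \<cdot>\<^bsub>C\<^esub> u = h)"

definition descend_along :: "('o, 'm, 'x) category_scheme \<Rightarrow> 'm \<Rightarrow> 'm \<Rightarrow> 'm" where
  "descend_along C q h = (THE u. u \<in> Hom C (Cod C q) (Cod C h) \<and> u \<cdot>\<^bsub>C\<^esub> q = h)"


section \<open>Cochain complexes\<close>

record ('o, 'm) complex_data =
  ob :: "int \<Rightarrow> 'o"
  diff :: "int \<Rightarrow> 'm"

record ('o, 'm) chain_map_data =
  src :: "('o, 'm) complex_data"
  tgt :: "('o, 'm) complex_data"
  cmp :: "int \<Rightarrow> 'm"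

definition is_complex ::
  "('o, 'm, 'x) preadditive_category_scheme \<Rightarrow> ('o, 'm) complex_data \<Rightarrow> bool" where
  "is_complex C A \<longleftrightarrow> (\<forall>i. ob A i \<in> Obj C \<and> diff A i \<in> Hom C (ob A i) (ob A (i + 1)) \<and>
     diff A (i + 1) \<cdot>\<^bsub>C\<^esub> diff A i = Zero C (ob A i) (ob A (i + 2)))"

definition is_chain_map ::
  "('o, 'm, 'x) preadditive_category_scheme \<Rightarrow> ('o, 'm) chain_map_data \<Rightarrow> bool" where
  "is_chain_map C f \<longleftrightarrow> is_complex C (src f) \<and> is_complex C (tgt f) \<and>
     (\<forall>i. cmp f i \<in> Hom C (ob (src f) i) (ob (tgt f) i) \<and>
          diff (tgt f) i \<cdot>\<^bsub>C\<^esub> cmp f i = cmp f (i + 1) \<cdot>\<^bsub>C\<^esub> diff (src f) i)"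

definition complex_category ::
  "('o, 'm, 'x) preadditive_category_scheme \<Rightarrow>
     (('o, 'm) complex_data, ('o, 'm) chain_map_data) category" where
  "complex_category C =
     \<lparr>Obj = {A. is_complex C A}, Arr = {f. is_chain_map C f}, Dom = src, Cod = tgt,
      Id = (\<lambda>A. \<lparr>src = A, tgt = A, cmp = (\<lambda>i. Id C (ob A i))\<rparr>),
      Comp = (\<lambda>g f. \<lparr>src = src f, tgt = tgt g, cmp = (\<lambda>i. cmp g i \<cdot>\<^bsub>C\<^esub> cmp f i)\<rparr>)\<rparr>"


section \<open>The homotopy category\<close>

definition is_homotopy ::
  "('o, 'm, 'x) preadditive_category_scheme \<Rightarrow> ('o, 'm) chain_map_data \<Rightarrow>
     ('o, 'm) chain_map_data \<Rightarrow> (int \<Rightarrow> 'm) \<Rightarrow> bool" where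
  "is_homotopy C f g k \<longleftrightarrow>
     (\<forall>i. k i \<in> Hom C (ob (src f) i) (ob (tgt f) (i - 1)) \<and>
          Minus C (cmp g i) (cmp f i) =
            Add C (diff (tgt f) (i - 1) \<cdot>\<^bsub>C\<^esub> k i) (k (i + 1) \<cdot>\<^bsub>C\<^esub> diff (src f) i))"

definition homotopy_rel ::
  "('o, 'm, 'x) preadditive_category_scheme \<Rightarrow> ('o, 'm) chain_map_data rel" where
  "homotopy_rel C = {(f, g). is_chain_map C f \<and> is_chain_map C g \<and>
     src f = src g \<and> tgt f = tgt g \<and> (\<exists>k. is_homotopy C f g k)}"

text \<open>An arrow of the homotopy category is a homotopy class of chain maps. Since a chain map
  records its source and target, so does its class.\<close>

definition homotopy_category ::
  "('o, 'm, 'x) preadditive_category_scheme \<Rightarrow>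
     (('o, 'm) complex_data, ('o, 'm) chain_map_data set) category" where
  "homotopy_category C =
     \<lparr>Obj = Obj (complex_category C),
      Arr = Arr (complex_category C) // homotopy_rel C,
      Dom = (\<lambda>F. the_elem (src ` F)),
      Cod = (\<lambda>F. the_elem (tgt ` F)),
      Id = (\<lambda>A. homotopy_rel C `` {Id (complex_category C) A}),
      Comp = (\<lambda>G F. homotopy_rel C `` {g \<cdot>\<^bsub>complex_category C\<^esub> f | g f. g \<in> G \<and> f \<in> F})\<rparr>"


section \<open>Cohomology and quasi-isomorphisms\<close>

text \<open>\<open>cocycles C A n\<close> is the inclusion of the kernel \<open>Z\<^sup>n(A)\<close> of the \<open>n\<close>-th differential,
  and \<open>cohomology_proj C A n\<close> is the projection from \<open>Z\<^sup>n(A)\<close> onto the quotient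
  \<open>H\<^sup>n(A)\<close> by the image of the preceding differential.\<close>

definition cocycles ::
  "('o, 'm, 'x) preadditive_category_scheme \<Rightarrow> ('o, 'm) complex_data \<Rightarrow> int \<Rightarrow> 'm" where
  "cocycles C A n = ker_arr C (diff A n)"

definition cohomology_proj ::
  "('o, 'm, 'x) preadditive_category_scheme \<Rightarrow> ('o, 'm) complex_data \<Rightarrow> int \<Rightarrow> 'm" where
  "cohomology_proj C A n =
     coker_arr C (lift_along C (cocycles C A n) (im_arr C (diff A (n - 1))))"

definition cohomology ::
  "('o, 'm, 'x) preadditive_category_scheme \<Rightarrow> ('o, 'm) complex_data \<Rightarrow> int \<Rightarrow> 'o" where
  "cohomology C A n = Cod C (cohomology_proj C A n)"

definition cocycles_map ::
  "('o, 'm, 'x) preadditive_category_scheme \<Rightarrow> ('o, 'm) chain_map_data \<Rightarrow> int \<Rightarrow> 'm" where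
  "cocycles_map C f n =
     lift_along C (cocycles C (tgt f) n) (cmp f n \<cdot>\<^bsub>C\<^esub> cocycles C (src f) n)"

definition cohomology_map ::
  "('o, 'm, 'x) preadditive_category_scheme \<Rightarrow> ('o, 'm) chain_map_data \<Rightarrow> int \<Rightarrow> 'm" where
  "cohomology_map C f n =
     descend_along C (cohomology_proj C (src f) n)
       (cohomology_proj C (tgt f) n \<cdot>\<^bsub>C\<^esub> cocycles_map C f n)"

definition quasi_iso_chain_map ::
  "('o, 'm, 'x) preadditive_category_scheme \<Rightarrow> ('o, 'm) chain_map_data \<Rightarrow> bool" where
  "quasi_iso_chain_map C f \<longleftrightarrow> is_chain_map C f \<and> (\<forall>n. is_iso C (cohomology_map C f n))"

text \<open>Homotopic chain maps induce the same map in cohomology, so it is immaterial which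
  representative of a class is tested.\<close>

definition quasi_iso ::
  "('o, 'm, 'x) preadditive_category_scheme \<Rightarrow> ('o, 'm) chain_map_data set \<Rightarrow> bool" where
  "quasi_iso C F \<longleftrightarrow> F \<in> Arr (homotopy_category C) \<and> (\<forall>f \<in> F. quasi_iso_chain_map C f)"

end

theory Submission
  imports Defs
begin

text \<open>Represent \<open>\<alpha>\<close> and \<open>\<beta>\<close> by chain maps \<open>a\<close> and \<open>b\<close>, and let \<open>K\<close> be the homotopy fibre of
  \<open>(a, -b)\<close>: \<open>K\<^sup>i = L\<^sup>i \<oplus> M\<^sup>i \<oplus> K'\<^sup>i\<^sup>-\<^sup>1\<close> with differential
  \<open>(l, m, k) \<mapsto> (d l, d m, a l - (b m + d k))\<close>. The third projection is a homotopy from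
  \<open>b \<circ> \<gamma>\<^sub>1\<close> to \<open>a \<circ> \<gamma>\<^sub>2\<close>, where \<open>\<gamma>\<^sub>2\<close> and \<open>\<gamma>\<^sub>1\<close> are the first two projections. That \<open>\<gamma>\<^sub>2\<close>
  is a quasi-isomorphism is a chase with generalised elements, i.e. arrows \<open>X \<rightarrow> A\<^sup>n\<close> considered up
  to precomposition with epimorphisms: since these are stable under pullback, being an
  isomorphism in cohomology can be tested as surjectivity and injectivity on such elements.\<close>

section \<open>Arithmetic of arrows\<close>

text \<open>A strict pullback of \<open>a\<close> and \<open>b\<close> need not have the cohomology
  of \<open>L\<close>, since \<open>b\<close> is only a quasi-isomorphism and may fail to be epic in
  each degree. The extra summand of the fibre relaxes the condition \<open>a l = b m\<close> to
  equality up to a chosen boundary, which is what a quasi-isomorphism can supply; the price is a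
  square that commutes only up to homotopy. The third component of the differential, signs included,
  is forced by asking that the third projection be that homotopy. Surjectivity of the first
  projection on H^n costs surjectivity of \<open>b\<close> on H^n. Injectivity on H^n costs
  injectivity of \<open>b\<close> on H^n and also surjectivity on H^(n-1), the latter to correct a
  first choice of preimage in \<open>M\<close>. Cohomology and its induced maps are given by
  \<open>SOME\<close> and \<open>THE\<close>, so these have to be shown to denote what is intended
  before they can be translated into \<open>coh_surj\<close> and \<open>coh_inj\<close>. Since
  \<open>quasi_iso\<close> tests every representative of a class, both conditions must also be
  invariant under homotopy.\<close>

lemma Hom_iff [simp]: "f \<in> Hom C a b \<longleftrightarrow> f \<in> Arr C \<and> Dom C f = a \<and> Cod C f = b"
  by (simp add: Hom_def)

context category
begin

lemma Dom_Obj [simp]: "f \<in> Arr C \<Longrightarrow> Dom C f \<in> Obj C"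
  and Cod_Obj [simp]: "f \<in> Arr C \<Longrightarrow> Cod C f \<in> Obj C"
  by (rule Dom_closed, simp) (rule Cod_closed, simp)

lemma Id_simps [simp]:
  assumes "a \<in> Obj C"
  shows "Id C a \<in> Arr C" "Dom C (Id C a) = a" "Cod C (Id C a) = a"
  using Id_Hom[OF assms] by auto

lemma Comp_simps [simp]:
  assumes "g \<in> Arr C" "f \<in> Arr C" "Dom C g = Cod C f"
  shows "g \<cdot> f \<in> Arr C" "Dom C (g \<cdot> f) = Dom C f" "Cod C (g \<cdot> f) = Cod C g"
  using Comp_Hom[of g "Cod C f" "Cod C g" f "Dom C f"] assms by auto

lemma Comp_assoc_simp [simp]:
  assumes "h \<in> Arr C" "g \<in> Arr C" "f \<in> Arr C" "Dom C h = Cod C g" "Dom C g = Cod C f"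
  shows "(h \<cdot> g) \<cdot> f = h \<cdot> (g \<cdot> f)"
  using Comp_assoc[of h "Cod C g" "Cod C h" g "Cod C f" f "Dom C f"] assms by auto

lemma Comp_Id_simp [simp]: "f \<in> Arr C \<Longrightarrow> a = Dom C f \<Longrightarrow> f \<cdot> Id C a = f"
  and Id_Comp_simp [simp]: "f \<in> Arr C \<Longrightarrow> b = Cod C f \<Longrightarrow> Id C b \<cdot> f = f"
  using Comp_Id[of f "Dom C f" "Cod C f"] Id_Comp[of f "Dom C f" "Cod C f"] by auto

text \<open>The simp rules associate composites to the right, which hides a product
  \<open>g f\<close> in front of a further factor; this form applies a known value of
  \<open>g f\<close> in that position.\<close>

lemma Comp_congL: "g \<cdot> f = h \<Longrightarrow> g \<in> Arr C \<Longrightarrow> f \<in> Arr C \<Longrightarrow> x \<in> Arr C \<Longrightarrow>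
  Dom C g = Cod C f \<Longrightarrow> Dom C f = Cod C x \<Longrightarrow> g \<cdot> (f \<cdot> x) = h \<cdot> x"
  using Comp_assoc_simp[of g f x] by simp

lemma mono_Arr [simp]: "is_mono C f \<Longrightarrow> f \<in> Arr C"
  by (simp add: is_mono_def)

lemma epi_Arr [simp]: "is_epi C f \<Longrightarrow> f \<in> Arr C"
  by (simp add: is_epi_def)

lemma monoD:
  assumes "is_mono C f" "f \<cdot> g = f \<cdot> h" "g \<in> Arr C" "h \<in> Arr C"
    "Cod C g = Dom C f" "Cod C h = Dom C f" "Dom C g = Dom C h"
  shows "g = h"
  using assms unfolding is_mono_def by (metis Hom_iff)

lemma epiD:
  assumes "is_epi C f" "g \<cdot> f = h \<cdot> f" "g \<in> Arr C" "h \<in> Arr C"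
    "Dom C g = Cod C f" "Dom C h = Cod C f" "Cod C g = Cod C h"
  shows "g = h"
  using assms unfolding is_epi_def by (metis Hom_iff)

lemma Id_epi: "a \<in> Obj C \<Longrightarrow> is_epi C (Id C a)"
  unfolding is_epi_def by (metis Comp_Id Hom_iff Id_simps(1,3))

lemma mono_comp:
  assumes "is_mono C f" "is_mono C g" "Dom C f = Cod C g"
  shows "is_mono C (f \<cdot> g)"
proof -
  have arr: "f \<in> Arr C" "g \<in> Arr C" using assms by auto
  show ?thesis unfolding is_mono_def
  proof (intro conjI allI ballI impI)
    fix a u v
    assume uv: "u \<in> Hom C a (Dom C (f \<cdot> g))" "v \<in> Hom C a (Dom C (f \<cdot> g))" "f \<cdot> g \<cdot> u = f \<cdot> g \<cdot> v"
    with arr assms have "f \<cdot> (g \<cdot> u) = f \<cdot> (g \<cdot> v)" by simp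
    then have "g \<cdot> u = g \<cdot> v" by (rule monoD[OF assms(1)]) (use uv arr assms in auto)
    then show "u = v" by (rule monoD[OF assms(2)]) (use uv arr assms in auto)
  qed (use arr assms in simp)
qed

lemma epi_comp:
  assumes "is_epi C f" "is_epi C g" "Dom C f = Cod C g"
  shows "is_epi C (f \<cdot> g)"
proof -
  have arr: "f \<in> Arr C" "g \<in> Arr C" using assms by auto
  show ?thesis unfolding is_epi_def
  proof (intro conjI allI ballI impI)
    fix b u v
    assume uv: "u \<in> Hom C (Cod C (f \<cdot> g)) b" "v \<in> Hom C (Cod C (f \<cdot> g)) b" "u \<cdot> (f \<cdot> g) = v \<cdot> (f \<cdot> g)"
    with arr assms have "(u \<cdot> f) \<cdot> g = (v \<cdot> f) \<cdot> g" by simp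
    then have "u \<cdot> f = v \<cdot> f" by (rule epiD[OF assms(2)]) (use uv arr assms in auto)
    then show "u = v" by (rule epiD[OF assms(1)]) (use uv arr assms in auto)
  qed (use arr assms in simp)
qed

end

section \<open>The abelian groups of arrows and their interaction with composition\<close>

context preadditive_category
begin

abbreviation add (infixl "\<oplus>" 65) where "f \<oplus> g \<equiv> Add C f g"

text \<open>This is the inverse occurring inside \<open>Minus\<close>; naming it lets every
  difference be treated as a sum.\<close>

definition neg :: "'m \<Rightarrow> 'm" ("\<ominus> _" [80] 80) where
  "\<ominus> f = inv\<^bsub>hom_group C (Dom C f) (Cod C f)\<^esub> f"

lemma Minus_eq: "Minus C f g = f \<oplus> \<ominus> g"
  by (simp add: Minus_def neg_def)

lemma hom_group_simps [simp]:
  "carrier (hom_group C a b) = Hom C a b"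
  "x \<otimes>\<^bsub>hom_group C a b\<^esub> y = x \<oplus> y"
  "\<one>\<^bsub>hom_group C a b\<^esub> = Zero C a b"
  by (auto simp: hom_group_def)

lemma Zero_simps [simp]:
  assumes "a \<in> Obj C" "b \<in> Obj C"
  shows "Zero C a b \<in> Arr C" "Dom C (Zero C a b) = a" "Cod C (Zero C a b) = b"
proof -
  interpret G: comm_group "hom_group C a b" using assms by (rule hom_comm_group)
  show "Zero C a b \<in> Arr C" "Dom C (Zero C a b) = a" "Cod C (Zero C a b) = b"
    using G.one_closed by auto
qed

context
  fixes f g assumes fg: "f \<in> Arr C" "g \<in> Arr C" "Dom C f = Dom C g" "Cod C f = Cod C g"
begin

interpretation G: comm_group "hom_group C (Dom C g) (Cod C g)"
  using fg by (intro hom_comm_group) auto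

lemma Add_simps [simp]: "f \<oplus> g \<in> Arr C" "Dom C (f \<oplus> g) = Dom C g" "Cod C (f \<oplus> g) = Cod C g"
  using G.m_closed[of f g] fg by auto

lemma neg_simps [simp]: "\<ominus> g \<in> Arr C" "Dom C (\<ominus> g) = Dom C g" "Cod C (\<ominus> g) = Cod C g"
  using G.inv_closed[of g] fg by (auto simp: neg_def)

lemma Add_comm: "f \<oplus> g = g \<oplus> f"
  using G.m_comm[of f g] fg by auto

lemma Add_assoc [simp]:
  assumes "h \<in> Arr C" "Dom C g = Dom C h" "Cod C g = Cod C h"
  shows "f \<oplus> g \<oplus> h = f \<oplus> (g \<oplus> h)"
  using G.m_assoc[of f g h] fg assms by auto

lemma Add_lcomm:
  assumes "h \<in> Arr C" "Dom C g = Dom C h" "Cod C g = Cod C h"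
  shows "f \<oplus> (g \<oplus> h) = g \<oplus> (f \<oplus> h)"
  using G.m_lcomm[of f g h] fg assms by auto

lemma neg_Add [simp]: "\<ominus> (f \<oplus> g) = \<ominus> f \<oplus> \<ominus> g"
  using G.inv_mult[of f g] fg by (simp add: neg_def)

lemma Add_cancel_neg [simp]: "f \<oplus> (\<ominus> f \<oplus> g) = g" "\<ominus> f \<oplus> (f \<oplus> g) = g"
  using G.inv_closed[of f] G.m_assoc[of "\<ominus> f" f g] G.m_assoc[of f "\<ominus> f" g] G.l_inv[of f] G.r_inv[of f]
    G.l_one[of g] fg
  by (auto simp: neg_def)

end

context
  fixes f assumes f: "f \<in> Arr C"
begin

interpretation G: comm_group "hom_group C (Dom C f) (Cod C f)"
  using f by (intro hom_comm_group) auto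

lemma neg_Arr [simp]: "\<ominus> f \<in> Arr C" "Dom C (\<ominus> f) = Dom C f" "Cod C (\<ominus> f) = Cod C f"
  using neg_simps[of f f] f by auto

lemma neg_neg [simp]: "\<ominus> \<ominus> f = f"
  using G.inv_inv[of f] f by (simp add: neg_def[of "\<ominus> f"]) (simp add: neg_def)

lemma Add_neg [simp]: "f \<oplus> \<ominus> f = Zero C (Dom C f) (Cod C f)" "\<ominus> f \<oplus> f = Zero C (Dom C f) (Cod C f)"
  using G.l_inv[of f] G.r_inv[of f] f by (auto simp: neg_def)

lemma Add_Zero [simp]:
  assumes "a = Dom C f" "b = Cod C f"
  shows "f \<oplus> Zero C a b = f" "Zero C a b \<oplus> f = f"
  using G.l_one[of f] G.r_one[of f] f assms by auto

lemma Add_self_eqD: "f \<oplus> f = f \<Longrightarrow> f = Zero C (Dom C f) (Cod C f)"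
  using G.l_cancel_one'[of f f] f by auto

end

lemma neg_unique:
  assumes "f \<oplus> g = Zero C (Dom C f) (Cod C f)" "f \<in> Arr C" "g \<in> Arr C" "Dom C g = Dom C f" "Cod C g = Cod C f"
  shows "g = \<ominus> f"
proof -
  have "\<ominus> f \<oplus> (f \<oplus> g) = \<ominus> f" using assms by (simp only: assms(1)) simp
  then show ?thesis using assms(2-) by simp
qed

lemma neg_Zero [simp]: "a \<in> Obj C \<Longrightarrow> b \<in> Obj C \<Longrightarrow> \<ominus> Zero C a b = Zero C a b"
  by (rule neg_unique[symmetric]) auto

lemma Add_eq_iff:
  assumes "f \<in> Arr C" "g \<in> Arr C" "h \<in> Arr C" "Dom C f = a" "Cod C f = b"
    "Dom C g = a" "Cod C g = b" "Dom C h = a" "Cod C h = b"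
  shows "h \<oplus> \<ominus> g = f \<longleftrightarrow> h = f \<oplus> g"
proof
  assume "h \<oplus> \<ominus> g = f"
  then have "f \<oplus> g = h \<oplus> \<ominus> g \<oplus> g" by simp
  then show "h = f \<oplus> g" using assms by simp
next
  assume h: "h = f \<oplus> g"
  show "h \<oplus> \<ominus> g = f" unfolding h using assms(1-7) by simp
qed

lemma Add_neg_eq_Zero_iff:
  assumes "f \<in> Arr C" "g \<in> Arr C" "Dom C f = a" "Cod C f = b" "Dom C g = a" "Cod C g = b"
  shows "f \<oplus> \<ominus> g = Zero C a b \<longleftrightarrow> f = g"
  using assms by (subst Add_eq_iff) auto

context
  fixes f g h
  assumes fgh: "f \<in> Arr C" "g \<in> Arr C" "h \<in> Arr C" "Dom C f = Dom C g" "Cod C f = Cod C g"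
begin

lemma Comp_Add_simp [simp]: "Dom C h = Cod C g \<Longrightarrow> h \<cdot> (f \<oplus> g) = h \<cdot> f \<oplus> h \<cdot> g"
  using Comp_Add[of h "Cod C g" "Cod C h" f "Dom C g" g] fgh by auto

lemma Add_Comp_simp [simp]: "Dom C g = Cod C h \<Longrightarrow> (f \<oplus> g) \<cdot> h = f \<cdot> h \<oplus> g \<cdot> h"
  using Add_Comp[of f "Dom C g" "Cod C g" g h "Dom C h"] fgh by auto

end

text \<open>By distributivity the composite equals its own double, and in a group only the neutral
  element does.\<close>

lemma Comp_Zero [simp]:
  assumes "h \<in> Arr C" "Dom C h = b" "a \<in> Obj C"
  shows "h \<cdot> Zero C a b = Zero C a (Cod C h)"
proof -
  have b: "b \<in> Obj C" using assms by auto
  have "h \<cdot> Zero C a b \<oplus> h \<cdot> Zero C a b = h \<cdot> (Zero C a b \<oplus> Zero C a b)"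
    using assms b by (intro Comp_Add_simp[symmetric]) auto
  also have "\<dots> = h \<cdot> Zero C a b"
    using assms b by (subst Add_Zero) auto
  finally show ?thesis using Add_self_eqD[of "h \<cdot> Zero C a b"] assms b by simp
qed

lemma Zero_Comp [simp]:
  assumes "h \<in> Arr C" "Cod C h = a" "b \<in> Obj C"
  shows "Zero C a b \<cdot> h = Zero C (Dom C h) b"
proof -
  have a: "a \<in> Obj C" using assms by auto
  have "Zero C a b \<cdot> h \<oplus> Zero C a b \<cdot> h = (Zero C a b \<oplus> Zero C a b) \<cdot> h"
    using assms a by (intro Add_Comp_simp[symmetric]) auto
  also have "\<dots> = Zero C a b \<cdot> h"
    using assms a by (subst Add_Zero) auto
  finally show ?thesis using Add_self_eqD[of "Zero C a b \<cdot> h"] assms a by simp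
qed

lemma Comp_neg [simp]:
  assumes "h \<in> Arr C" "f \<in> Arr C" "Dom C h = Cod C f"
  shows "h \<cdot> \<ominus> f = \<ominus> (h \<cdot> f)"
  using assms by (intro neg_unique) (auto simp flip: Comp_Add_simp)

lemma neg_Comp [simp]:
  assumes "h \<in> Arr C" "f \<in> Arr C" "Dom C h = Cod C f"
  shows "\<ominus> h \<cdot> f = \<ominus> (h \<cdot> f)"
  using assms by (intro neg_unique) (auto simp flip: Add_Comp_simp)

text \<open>Cancellation is tested on the difference of the two arrows, so a trivial kernel
  suffices.\<close>

lemma monoI:
  assumes "f \<in> Arr C"
    and "\<And>x g. g \<in> Hom C x (Dom C f) \<Longrightarrow> f \<cdot> g = Zero C x (Cod C f) \<Longrightarrow> g = Zero C x (Dom C f)"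
  shows "is_mono C f"
  unfolding is_mono_def
proof (intro conjI allI ballI impI)
  fix a g h assume *: "g \<in> Hom C a (Dom C f)" "h \<in> Hom C a (Dom C f)" "f \<cdot> g = f \<cdot> h"
  have "f \<cdot> (g \<oplus> \<ominus> h) = f \<cdot> g \<oplus> \<ominus> (f \<cdot> h)" using * assms(1) by simp
  also have "\<dots> = Zero C a (Cod C f)" unfolding *(3) using * assms(1) by simp
  finally have "g \<oplus> \<ominus> h = Zero C a (Dom C f)" by (rule assms(2)[rotated]) (use * in simp)
  then show "g = h" using * by (subst (asm) Add_neg_eq_Zero_iff) auto
qed fact

lemma epiI:
  assumes "f \<in> Arr C"
    and "\<And>x g. g \<in> Hom C (Cod C f) x \<Longrightarrow> g \<cdot> f = Zero C (Dom C f) x \<Longrightarrow> g = Zero C (Cod C f) x"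
  shows "is_epi C f"
  unfolding is_epi_def
proof (intro conjI allI ballI impI)
  fix b g h assume *: "g \<in> Hom C (Cod C f) b" "h \<in> Hom C (Cod C f) b" "g \<cdot> f = h \<cdot> f"
  have "(g \<oplus> \<ominus> h) \<cdot> f = g \<cdot> f \<oplus> \<ominus> (h \<cdot> f)" using * assms(1) by simp
  also have "\<dots> = Zero C (Dom C f) b" unfolding *(3) using * assms(1) by auto
  finally have "g \<oplus> \<ominus> h = Zero C (Cod C f) b" by (rule assms(2)[rotated]) (use * in simp)
  then show "g = h" using * by (subst (asm) Add_neg_eq_Zero_iff) auto
qed fact

lemma mono_ZeroD:
  assumes "is_mono C f" "f \<cdot> g = Zero C x (Cod C f)" "g \<in> Hom C x (Dom C f)"
  shows "g = Zero C x (Dom C f)"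
  by (rule monoD[OF assms(1)]) (use assms mono_Arr[OF assms(1)] in auto)

lemma epi_ZeroD:
  assumes "is_epi C f" "g \<cdot> f = Zero C (Dom C f) x" "g \<in> Hom C (Cod C f) x"
  shows "g = Zero C (Cod C f) x"
  by (rule epiD[OF assms(1)]) (use assms epi_Arr[OF assms(1)] in auto)

section \<open>Universal properties of kernels and cokernels\<close>

lemma kernelD:
  assumes "is_kernel C f k"
  shows "f \<in> Arr C" "k \<in> Arr C" "Cod C k = Dom C f" "f \<cdot> k = Zero C (Dom C k) (Cod C f)"
  using assms by (auto simp: is_kernel_def)

lemma cokernelD:
  assumes "is_cokernel C f q"
  shows "f \<in> Arr C" "q \<in> Arr C" "Dom C q = Cod C f" "q \<cdot> f = Zero C (Dom C f) (Cod C q)"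
  using assms by (auto simp: is_cokernel_def)

lemma kernel_lift:
  assumes "is_kernel C f k" "h \<in> Arr C" "Cod C h = Dom C f" "f \<cdot> h = Zero C (Dom C h) (Cod C f)"
  obtains u where "u \<in> Hom C (Dom C h) (Dom C k)" "k \<cdot> u = h"
proof -
  have "h \<in> Hom C (Dom C h) (Dom C f)" using assms by simp
  then show ?thesis using assms that unfolding is_kernel_def by blast
qed

lemma cokernel_descend:
  assumes "is_cokernel C f q" "h \<in> Arr C" "Dom C h = Cod C f" "h \<cdot> f = Zero C (Dom C f) (Cod C h)"
  obtains u where "u \<in> Hom C (Cod C q) (Cod C h)" "u \<cdot> q = h"
proof -
  have "h \<in> Hom C (Cod C f) (Cod C h)" using assms by simp
  then show ?thesis using assms that unfolding is_cokernel_def by blast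
qed

lemma kernel_mono:
  assumes "is_kernel C f k"
  shows "is_mono C k"
  unfolding is_mono_def
proof (intro conjI allI ballI impI)
  note k = kernelD[OF assms]
  fix a g h assume *: "g \<in> Hom C a (Dom C k)" "h \<in> Hom C a (Dom C k)" "k \<cdot> g = k \<cdot> h"
  have "f \<cdot> (k \<cdot> g) = (f \<cdot> k) \<cdot> g" using k(1-3) * by simp
  also have "\<dots> = Zero C a (Cod C f)" unfolding k(4) using k(1-3) * by auto
  finally have "f \<cdot> (k \<cdot> g) = Zero C a (Cod C f)" .
  moreover have "k \<cdot> g \<in> Hom C a (Dom C f)" using k(1-3) * by simp
  ultimately have "\<exists>!u. u \<in> Hom C a (Dom C k) \<and> k \<cdot> u = k \<cdot> g"
    using assms unfolding is_kernel_def by blast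
  then show "g = h" using * by metis
qed (use kernelD[OF assms] in simp)

lemma cokernel_epi:
  assumes "is_cokernel C f q"
  shows "is_epi C q"
  unfolding is_epi_def
proof (intro conjI allI ballI impI)
  note q = cokernelD[OF assms]
  fix b g h assume *: "g \<in> Hom C (Cod C q) b" "h \<in> Hom C (Cod C q) b" "g \<cdot> q = h \<cdot> q"
  have "(g \<cdot> q) \<cdot> f = g \<cdot> (q \<cdot> f)" using q(1-3) *(1,2) by simp
  also have "\<dots> = Zero C (Dom C f) b" unfolding q(4) using q(1-3) *(1,2) by auto
  finally have "(g \<cdot> q) \<cdot> f = Zero C (Dom C f) b" .
  moreover have "g \<cdot> q \<in> Hom C (Cod C f) b" using q(1-3) *(1,2) by simp
  ultimately have "\<exists>!u. u \<in> Hom C (Cod C q) b \<and> u \<cdot> q = g \<cdot> q"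
    using assms unfolding is_cokernel_def by blast
  then show "g = h" using * by metis
qed (use cokernelD[OF assms] in simp)

end

section \<open>Abelian categories\<close>

context abelian_category
begin

lemma ker_arr: "f \<in> Arr C \<Longrightarrow> is_kernel C f (ker_arr C f)"
  unfolding ker_arr_def by (rule someI_ex[OF ex_kernel])

lemma coker_arr: "f \<in> Arr C \<Longrightarrow> is_cokernel C f (coker_arr C f)"
  unfolding coker_arr_def by (rule someI_ex[OF ex_cokernel])

text \<open>Every epimorphism is the cokernel of its kernel: \<open>f\<close> is the cokernel of
  some \<open>h\<close>, and \<open>h\<close> factors through \<open>k\<close> because
  \<open>f h = 0\<close>; hence whatever kills \<open>k\<close> kills \<open>h\<close> and
  descends.\<close>

lemma epi_factor_through:
  assumes "is_epi C f" "is_kernel C f k" "g \<in> Arr C" "Dom C g = Dom C f" "g \<cdot> k = Zero C (Dom C k) (Cod C g)"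
  obtains u where "u \<in> Hom C (Cod C f) (Cod C g)" "u \<cdot> f = g"
proof -
  obtain h where h: "is_cokernel C h f" using epi_is_cokernel[OF assms(1)] by blast
  note h' = cokernelD[OF h] and k = kernelD[OF assms(2)]
  obtain v where v: "v \<in> Hom C (Dom C h) (Dom C k)" "k \<cdot> v = h"
    using kernel_lift[OF assms(2), of h] h' by auto
  have "g \<cdot> h = (g \<cdot> k) \<cdot> v" using v k(1-3) assms(3,4) by auto
  also have "\<dots> = Zero C (Dom C h) (Cod C g)" unfolding assms(5) using v k assms(3,4) by auto
  finally show ?thesis using cokernel_descend[OF h assms(3)] that assms(3,4) h' by metis
qed

text \<open>Dual to \<open>epi_factor_through\<close>: every monomorphism is the kernel of its
  cokernel.\<close>

lemma mono_factor_through: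
  assumes "is_mono C f" "is_cokernel C f q" "g \<in> Arr C" "Cod C g = Cod C f" "q \<cdot> g = Zero C (Dom C g) (Cod C q)"
  obtains u where "u \<in> Hom C (Dom C g) (Dom C f)" "f \<cdot> u = g"
proof -
  obtain h where h: "is_kernel C h f" using mono_is_kernel[OF assms(1)] by blast
  note h' = kernelD[OF h] and q = cokernelD[OF assms(2)]
  obtain v where v: "v \<in> Hom C (Cod C q) (Cod C h)" "v \<cdot> q = h"
    using cokernel_descend[OF assms(2), of h] h' by auto
  have "h \<cdot> g = v \<cdot> (q \<cdot> g)" using v q(1-3) assms(3,4) by auto
  also have "\<dots> = Zero C (Dom C g) (Cod C h)" unfolding assms(5) using v q assms(3,4) by auto
  finally show ?thesis using kernel_lift[OF h assms(3)] that assms(3,4) h' by metis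
qed

text \<open>The kernel of a monomorphism is zero, so the identity kills it and factors through the
  epimorphism \<open>f\<close>. This gives a left inverse, and cancelling \<open>f\<close> makes it
  two-sided.\<close>

lemma mono_epi_iso:
  assumes "is_mono C f" "is_epi C f"
  shows "is_iso C f"
proof -
  obtain k where k: "is_kernel C f k" using ex_kernel[OF mono_Arr[OF assms(1)]] by blast
  note k' = kernelD[OF k]
  have f: "f \<in> Arr C" using assms by simp
  have "k = Zero C (Dom C k) (Dom C f)"
    by (rule mono_ZeroD[OF assms(1)]) (use k' in auto)
  then have "Id C (Dom C f) \<cdot> k = Zero C (Dom C k) (Dom C f)" using k' f by simp
  then obtain u where u: "u \<in> Hom C (Cod C f) (Dom C f)" "u \<cdot> f = Id C (Dom C f)"
    using epi_factor_through[OF assms(2) k, of "Id C (Dom C f)"] f by auto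
  have "(f \<cdot> u) \<cdot> f = Id C (Cod C f) \<cdot> f" using u f by simp
  then have "f \<cdot> u = Id C (Cod C f)" by (rule epiD[OF assms(2)]) (use u f in auto)
  then show ?thesis using u f unfolding is_iso_def by blast
qed

section \<open>Image factorisation and pullbacks of epimorphisms\<close>

lemma im_arr:
  assumes "f \<in> Arr C"
  shows "is_kernel C (coker_arr C f) (im_arr C f)" "is_mono C (im_arr C f)" "Cod C (im_arr C f) = Cod C f"
proof -
  note q = cokernelD[OF coker_arr[OF assms]]
  show *: "is_kernel C (coker_arr C f) (im_arr C f)"
    unfolding im_arr_def by (rule ker_arr) (rule q)
  show "is_mono C (im_arr C f)" "Cod C (im_arr C f) = Cod C f"
    using kernel_mono[OF *] kernelD(3)[OF *] q(3) by auto
qed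

text \<open>The point is that \<open>e\<close> is epic. If \<open>g e = 0\<close>, then
  \<open>e\<close> passes through the kernel \<open>k\<close> of \<open>g\<close>, so
  \<open>f\<close> passes through the smaller subobject \<open>m k\<close>. But \<open>m k\<close>
  is itself the kernel of some \<open>r\<close>, and \<open>r\<close> kills \<open>f\<close>, hence
  factors through the cokernel of \<open>f\<close>, hence kills \<open>m\<close>. So
  \<open>m\<close> factors through \<open>m k\<close>, which splits \<open>k\<close> and forces
  \<open>g = 0\<close>.\<close>

lemma im_factor:
  assumes f: "f \<in> Arr C"
  obtains e where "is_epi C e" "e \<in> Hom C (Dom C f) (Dom C (im_arr C f))" "im_arr C f \<cdot> e = f"
proof -
  define q m where "q = coker_arr C f" and "m = im_arr C f"
  have coker: "is_cokernel C f q" and ker: "is_kernel C q m"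
    using coker_arr im_arr f by (auto simp: q_def m_def)
  note q = cokernelD[OF coker] and m = kernelD[OF ker]
  obtain e where e: "e \<in> Hom C (Dom C f) (Dom C m)" "m \<cdot> e = f"
    using kernel_lift[OF ker f] q by auto
  have "is_epi C e"
  proof (rule epiI)
    fix x g assume g: "g \<in> Hom C (Cod C e) x" "g \<cdot> e = Zero C (Dom C e) x"
    define k where "k = ker_arr C g"
    have kker: "is_kernel C g k" using ker_arr g by (auto simp: k_def)
    note k = kernelD[OF kker]
    obtain e' where e': "e' \<in> Hom C (Dom C e) (Dom C k)" "k \<cdot> e' = e"
      using kernel_lift[OF kker, of e] e g by auto
    have mk: "is_mono C (m \<cdot> k)"
      using kernel_mono[OF ker] kernel_mono[OF kker] k g e by (intro mono_comp) auto
    then obtain r where rker: "is_kernel C r (m \<cdot> k)" using mono_is_kernel by blast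
    note r = kernelD[OF rker]
    have r3: "Dom C r = Cod C f" using r(3) m k g e q by auto
    have "r \<cdot> f = (r \<cdot> (m \<cdot> k)) \<cdot> e'" using e e' r(1,2) r3 m k g q by auto
    also have "\<dots> = Zero C (Dom C f) (Cod C r)" unfolding r(4) using e e' r(1,2) r3 m k g by auto
    finally obtain s where s: "s \<in> Hom C (Cod C q) (Cod C r)" "s \<cdot> q = r"
      using cokernel_descend[OF coker, of r] r(1) r3 by auto
    have "r \<cdot> m = s \<cdot> (q \<cdot> m)" using s q m by auto
    also have "\<dots> = Zero C (Dom C m) (Cod C r)" unfolding m(4) using s q m by auto
    finally obtain t where t: "t \<in> Hom C (Dom C m) (Dom C (m \<cdot> k))" "(m \<cdot> k) \<cdot> t = m"
      using kernel_lift[OF rker, of m] m r3 q by auto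
    have "m \<cdot> (k \<cdot> t) = m \<cdot> Id C (Dom C m)" using t m k g e by auto
    then have kt: "k \<cdot> t = Id C (Dom C m)" by (rule monoD[OF kernel_mono[OF ker]]) (use t m k g e in auto)
    have "g = g \<cdot> (k \<cdot> t)" unfolding kt using g(1) e(1) by simp
    also have "\<dots> = (g \<cdot> k) \<cdot> t" using t(1) k(2,3) g(1) e(1) m by simp
    also have "\<dots> = Zero C (Cod C e) x" unfolding k(4) using t(1) k(2,3) g(1) e(1) m by auto
    finally show "g = Zero C (Cod C e) x" .
  qed (use e in simp)
  then show ?thesis using that e by (auto simp: m_def)
qed

text \<open>The pullback is the kernel of \<open>e p1 - u p2\<close> on the product of the two
  domains. This lemma is what permits choosing preimages of generalised elements, at the cost of
  composing with an epimorphism.\<close>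

lemma epi_pullback:
  assumes e: "is_epi C e" and u: "u \<in> Arr C" "Cod C u = Cod C e"
  obtains p v where "is_epi C p" "Cod C p = Dom C u" "v \<in> Hom C (Dom C p) (Dom C e)" "e \<cdot> v = u \<cdot> p"
proof -
  have e': "e \<in> Arr C" using e by simp
  obtain b p1 p2 where prod: "is_product C (Dom C e) (Dom C u) b p1 p2"
    using ex_product[OF Dom_Obj[OF e'] Dom_Obj[OF u(1)]] by blast
  have b: "b \<in> Obj C" and p1: "p1 \<in> Arr C" "Dom C p1 = b" "Cod C p1 = Dom C e"
    and p2: "p2 \<in> Arr C" "Dom C p2 = b" "Cod C p2 = Dom C u"
    using prod by (auto simp: is_product_def)
  have "\<exists>i. i \<in> Hom C (Dom C e) b \<and> p1 \<cdot> i = Id C (Dom C e) \<and> p2 \<cdot> i = Zero C (Dom C e) (Dom C u)"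
  proof -
    have "Id C (Dom C e) \<in> Hom C (Dom C e) (Dom C e)" "Zero C (Dom C e) (Dom C u) \<in> Hom C (Dom C e) (Dom C u)"
      using e' u(1) by auto
    then show ?thesis using prod Dom_Obj[OF e'] unfolding is_product_def by blast
  qed
  then obtain i where i: "i \<in> Arr C" "Dom C i = Dom C e" "Cod C i = b"
      "p1 \<cdot> i = Id C (Dom C e)" "p2 \<cdot> i = Zero C (Dom C e) (Dom C u)"
    by auto
  \<comment> \<open>\<open>i\<close> is the inclusion of the first factor, obtained from the
    universal property of the product. Since \<open>w i = e\<close>, the difference \<open>w\<close>
    inherits being epic from \<open>e\<close>.\<close>
  define w where "w = e \<cdot> p1 \<oplus> \<ominus> (u \<cdot> p2)"
  have w: "w \<in> Arr C" "Dom C w = b" "Cod C w = Cod C e"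
    using e' u p1 p2 by (auto simp: w_def)
  have wi: "w \<cdot> i = e" using e' u p1 p2 i by (simp add: w_def)
  have wepi: "is_epi C w"
  proof (rule epiI)
    fix x g assume g: "g \<in> Hom C (Cod C w) x" "g \<cdot> w = Zero C (Dom C w) x"
    have "g \<cdot> e = (g \<cdot> w) \<cdot> i" using g(1) w i e' wi by auto
    also have "\<dots> = Zero C (Dom C e) x" unfolding g(2) using g(1) w i by auto
    finally show "g = Zero C (Cod C w) x" using epi_ZeroD[OF e, of g x] g(1) w by auto
  qed (rule w)
  define k where "k = ker_arr C w"
  have kker: "is_kernel C w k" using ker_arr w by (simp add: k_def)
  note k = kernelD[OF kker]
  have k3: "Cod C k = b" using k w by simp
  have "is_epi C (p2 \<cdot> k)"
  proof (rule epiI)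
    fix x g assume g: "g \<in> Hom C (Cod C (p2 \<cdot> k)) x" "g \<cdot> (p2 \<cdot> k) = Zero C (Dom C (p2 \<cdot> k)) x"
    have g': "g \<in> Arr C" "Dom C g = Dom C u" "Cod C g = x" using g(1) p2 k(2) k3 by auto
    have "(g \<cdot> p2) \<cdot> k = Zero C (Dom C k) x" using g(2) g' p2 k(2) k3 by auto
    then obtain s where s: "s \<in> Arr C" "Dom C s = Cod C e" "Cod C s = x" "s \<cdot> w = g \<cdot> p2"
      using epi_factor_through[OF wepi kker, of "g \<cdot> p2"] g' p2 w by auto
    \<comment> \<open>Restricting \<open>s w = g p2\<close> along the first inclusion gives
      \<open>s e = 0\<close>, because \<open>p2 i = 0\<close>. Thus \<open>s\<close> and
      \<open>g p2\<close> vanish, and the second inclusion \<open>j\<close>, a section of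
      \<open>p2\<close>, then gives \<open>g = 0\<close>.\<close>
    have "s \<cdot> e = (s \<cdot> w) \<cdot> i" using s(1-3) w i wi by auto
    also have "\<dots> = Zero C (Dom C e) x" unfolding s(4) using g' p2 i e' by auto
    finally have s0: "s = Zero C (Cod C e) x" using epi_ZeroD[OF e, of s x] s(1-3) by auto
    have "g \<cdot> p2 = Zero C b x" unfolding s(4)[symmetric] s0 using g'(1,3) w e' by auto
    moreover
    have "\<exists>j. j \<in> Hom C (Dom C u) b \<and> p1 \<cdot> j = Zero C (Dom C u) (Dom C e) \<and> p2 \<cdot> j = Id C (Dom C u)"
    proof -
      have "Id C (Dom C u) \<in> Hom C (Dom C u) (Dom C u)" "Zero C (Dom C u) (Dom C e) \<in> Hom C (Dom C u) (Dom C e)"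
        using e' u(1) by auto
      then show ?thesis using prod Dom_Obj[OF u(1)] unfolding is_product_def by blast
    qed
    then obtain j where j: "j \<in> Arr C" "Dom C j = Dom C u" "Cod C j = b" "p2 \<cdot> j = Id C (Dom C u)"
      by auto
    ultimately have "(g \<cdot> p2) \<cdot> j = Zero C (Dom C u) x" using g' by auto
    then show "g = Zero C (Cod C (p2 \<cdot> k)) x" using g' p2 j k(2) k3 by simp
  qed (use p2 k(2) k3 in simp)
  moreover have "e \<cdot> (p1 \<cdot> k) \<oplus> \<ominus> (u \<cdot> (p2 \<cdot> k)) = w \<cdot> k"
    unfolding w_def using e' u p1 p2 k(2) k3 by simp
  then have "e \<cdot> (p1 \<cdot> k) \<oplus> \<ominus> (u \<cdot> (p2 \<cdot> k)) = Zero C (Dom C k) (Cod C e)"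
    unfolding k(4) w(3) .
  then have "e \<cdot> (p1 \<cdot> k) = u \<cdot> (p2 \<cdot> k)"
    by (subst (asm) Add_neg_eq_Zero_iff) (use e' u p1 p2 k(2) k3 in auto)
  ultimately show ?thesis
    using p1 p2 k(2) k3 by (intro that[of "p2 \<cdot> k" "p1 \<cdot> k"]) auto
qed

end

section \<open>Cohomology in terms of generalised elements\<close>

context preadditive_category
begin

lemma complex_simps [simp]:
  assumes "is_complex C A"
  shows "ob A i \<in> Obj C" "diff A i \<in> Arr C" "Dom C (diff A i) = ob A i" "Cod C (diff A i) = ob A (i + 1)"
  using assms by (auto simp: is_complex_def)

text \<open>The upper index is a separate variable so that the rule also matches pairs such as
  \<open>n - 1\<close> and \<open>n\<close>; the same device recurs in the lemmas on chain maps and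
  on the fibre.\<close>

lemma diff_diff [simp]:
  assumes "is_complex C A" "j = i + 1"
  shows "diff A j \<cdot> diff A i = Zero C (ob A i) (ob A (j + 1))"
proof -
  have "diff A (i + 1) \<cdot> diff A i = Zero C (ob A i) (ob A (i + 2))"
    using assms(1) unfolding is_complex_def by blast
  then show ?thesis using assms(2) by (simp add: add.commute)
qed

lemma diff_diff_comp [simp]:
  assumes "is_complex C A" "j = i + 1" "x \<in> Arr C" "Cod C x = ob A i"
  shows "diff A j \<cdot> (diff A i \<cdot> x) = Zero C (Dom C x) (ob A (j + 1))"
proof -
  have "diff A j \<cdot> (diff A i \<cdot> x) = (diff A j \<cdot> diff A i) \<cdot> x"
    using assms by (simp del: diff_diff)
  also have "\<dots> = Zero C (Dom C x) (ob A (j + 1))"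
    unfolding diff_diff[OF assms(1,2)] using assms by simp
  finally show ?thesis .
qed

lemma chain_map_simps [simp]:
  assumes "is_chain_map C f"
  shows "is_complex C (src f)" "is_complex C (tgt f)" "cmp f i \<in> Arr C"
    "Dom C (cmp f i) = ob (src f) i" "Cod C (cmp f i) = ob (tgt f) i"
  using assms by (auto simp: is_chain_map_def)

lemma chain_map_commute:
  assumes "is_chain_map C f" "j = i + 1"
  shows "cmp f j \<cdot> diff (src f) i = diff (tgt f) i \<cdot> cmp f i"
proof -
  have "diff (tgt f) i \<cdot> cmp f i = cmp f (i + 1) \<cdot> diff (src f) i"
    using assms(1) unfolding is_chain_map_def by blast
  then show ?thesis using assms(2) by simp
qed

lemma chain_map_commute_comp:
  assumes "is_chain_map C f" "j = i + 1" "x \<in> Arr C" "Cod C x = ob (src f) i"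
  shows "cmp f j \<cdot> (diff (src f) i \<cdot> x) = diff (tgt f) i \<cdot> (cmp f i \<cdot> x)"
  using Comp_congL[OF chain_map_commute[OF assms(1,2)], of x] assms by simp

lemma lift_along_eq:
  assumes "is_mono C k" "u \<in> Hom C (Dom C h) (Dom C k)" "k \<cdot> u = h"
  shows "lift_along C k h = u"
  unfolding lift_along_def
proof (rule the_equality)
  fix v assume v: "v \<in> Hom C (Dom C h) (Dom C k) \<and> k \<cdot> v = h"
  then have "k \<cdot> v = k \<cdot> u" using assms by simp
  then show "v = u" by (rule monoD[OF assms(1)]) (use v assms(2) in simp_all)
qed (use assms in simp)

lemma descend_along_eq:
  assumes "is_epi C q" "u \<in> Hom C (Cod C q) (Cod C h)" "u \<cdot> q = h"
  shows "descend_along C q h = u"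
  unfolding descend_along_def
proof (rule the_equality)
  fix v assume v: "v \<in> Hom C (Cod C q) (Cod C h) \<and> v \<cdot> q = h"
  then have "v \<cdot> q = u \<cdot> q" using assms by simp
  then show "v = u" by (rule epiD[OF assms(1)]) (use v assms(2) in simp_all)
qed (use assms in simp)

text \<open>Arrows \<open>z\<close> into \<open>A\<^sup>n\<close> play the role of elements of \<open>A\<^sup>n\<close>; existence of an element
  becomes existence after composing with an epimorphism \<open>p\<close>.\<close>

definition coh_surj :: "('o, 'm) chain_map_data \<Rightarrow> int \<Rightarrow> bool" where
  "coh_surj f n \<longleftrightarrow> (\<forall>z \<in> Arr C. Cod C z = ob (tgt f) n \<and>
       diff (tgt f) n \<cdot> z = Zero C (Dom C z) (ob (tgt f) (n + 1)) \<longrightarrow>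
     (\<exists>p c e. is_epi C p \<and> Cod C p = Dom C z \<and>
       c \<in> Hom C (Dom C p) (ob (src f) n) \<and> e \<in> Hom C (Dom C p) (ob (tgt f) (n - 1)) \<and>
       diff (src f) n \<cdot> c = Zero C (Dom C p) (ob (src f) (n + 1)) \<and>
       z \<cdot> p = cmp f n \<cdot> c \<oplus> diff (tgt f) (n - 1) \<cdot> e))"

text \<open>The boundary condition on the image of \<open>z\<close> is imposed outright rather than
  after an epimorphism. Nothing is lost, since \<open>z\<close> may be replaced by its composite
  with that epimorphism.\<close>

definition coh_inj :: "('o, 'm) chain_map_data \<Rightarrow> int \<Rightarrow> bool" where
  "coh_inj f n \<longleftrightarrow> (\<forall>z \<in> Arr C. \<forall>e \<in> Hom C (Dom C z) (ob (tgt f) (n - 1)). Cod C z = ob (src f) n \<and>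
       diff (src f) n \<cdot> z = Zero C (Dom C z) (ob (src f) (n + 1)) \<and>
       cmp f n \<cdot> z = diff (tgt f) (n - 1) \<cdot> e \<longrightarrow>
     (\<exists>p e'. is_epi C p \<and> Cod C p = Dom C z \<and> e' \<in> Hom C (Dom C p) (ob (src f) (n - 1)) \<and>
       z \<cdot> p = diff (src f) (n - 1) \<cdot> e'))"

end

context abelian_category
begin

section \<open>Cocycles, boundaries and the projection onto cohomology\<close>

context
  fixes A assumes A: "is_complex C A"
begin

lemma cocycles_kernel: "is_kernel C (diff A n) (cocycles C A n)"
  unfolding cocycles_def by (rule ker_arr) (use A in simp)

lemma cocycles_mono [simp]: "is_mono C (cocycles C A n)"
  by (rule kernel_mono[OF cocycles_kernel])

lemma cocycles_simps [simp]:
  "cocycles C A n \<in> Arr C" "Cod C (cocycles C A n) = ob A n"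
  "diff A n \<cdot> cocycles C A n = Zero C (Dom C (cocycles C A n)) (ob A (n + 1))"
  using kernelD[OF cocycles_kernel[of n]] A by auto

lemma cocycles_lift:
  assumes "z \<in> Arr C" "Cod C z = ob A n" "diff A n \<cdot> z = Zero C (Dom C z) (ob A (n + 1))"
  obtains z' where "z' \<in> Hom C (Dom C z) (Dom C (cocycles C A n))" "cocycles C A n \<cdot> z' = z"
  using kernel_lift[OF cocycles_kernel[of n], of z] assms A by auto

text \<open>Makes the \<open>THE\<close> in \<open>cohomology_proj\<close> meaningful. The
  differential kills the image of its predecessor because it kills the composite with the
  epimorphism onto that image, which is the predecessor itself.\<close>

lemma boundaries_cocycles:
  fixes n
  defines "j \<equiv> lift_along C (cocycles C A n) (im_arr C (diff A (n - 1)))"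
  shows "j \<in> Hom C (Dom C (im_arr C (diff A (n - 1)))) (Dom C (cocycles C A n))"
    "cocycles C A n \<cdot> j = im_arr C (diff A (n - 1))"
proof -
  define d m where "d = diff A (n - 1)" and "m = im_arr C (diff A (n - 1))"
  have d: "d \<in> Arr C" "Dom C d = ob A (n - 1)" "Cod C d = ob A n" using A by (simp_all add: d_def)
  obtain e where e: "is_epi C e" "e \<in> Arr C" "Dom C e = ob A (n - 1)" "Cod C e = Dom C m" "m \<cdot> e = d"
    using im_factor[OF d(1)] d unfolding m_def d_def by auto
  have m: "m \<in> Arr C" "is_mono C m" "Cod C m = ob A n"
    using im_arr[OF d(1)] d by (auto simp: m_def d_def)
  have "(diff A n \<cdot> m) \<cdot> e = diff A n \<cdot> d" unfolding e(5)[symmetric] using e(1-4) m A by simp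
  also have "\<dots> = Zero C (Dom C e) (ob A (n + 1))" using A by (simp add: d_def e)
  finally have "diff A n \<cdot> m = Zero C (Dom C m) (ob A (n + 1))"
    using epi_ZeroD[OF e(1), of "diff A n \<cdot> m" "ob A (n + 1)"] e(2-4) m A by simp
  then obtain u where u: "u \<in> Hom C (Dom C m) (Dom C (cocycles C A n))" "cocycles C A n \<cdot> u = m"
    by (rule cocycles_lift[OF m(1,3)])
  then have "j = u" unfolding j_def m_def[symmetric] by (intro lift_along_eq cocycles_mono)
  then show "j \<in> Hom C (Dom C (im_arr C (diff A (n - 1)))) (Dom C (cocycles C A n))"
    "cocycles C A n \<cdot> j = im_arr C (diff A (n - 1))"
    using u by (simp_all add: m_def)
qed

lemma cohomology_proj_cokernel:
  "is_cokernel C (lift_along C (cocycles C A n) (im_arr C (diff A (n - 1)))) (cohomology_proj C A n)"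
  unfolding cohomology_proj_def by (rule coker_arr) (use boundaries_cocycles in simp)

lemma cohomology_proj_epi [simp]: "is_epi C (cohomology_proj C A n)"
  by (rule cokernel_epi[OF cohomology_proj_cokernel])

lemma cohomology_proj_Dom [simp]: "Dom C (cohomology_proj C A n) = Dom C (cocycles C A n)"
  using cokernelD(3)[OF cohomology_proj_cokernel] boundaries_cocycles by simp

text \<open>The dictionary between classes and elements. A cocycle of class zero factors through the
  boundaries, since the mono \<open>j\<close> is the kernel of its cokernel \<open>q\<close>;
  pulling back the epimorphism from degree \<open>n - 1\<close> onto the image then yields a
  preimage. Conversely a local preimage gives \<open>q c p = 0\<close>, and \<open>p\<close>
  cancels.\<close>

lemma cohomology_proj_Comp_eq_Zero_iff:
  assumes c: "c \<in> Arr C" "Cod C c = Dom C (cocycles C A n)"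
  shows "cohomology_proj C A n \<cdot> c = Zero C (Dom C c) (Cod C (cohomology_proj C A n)) \<longleftrightarrow>
    (\<exists>p e. is_epi C p \<and> Cod C p = Dom C c \<and> e \<in> Hom C (Dom C p) (ob A (n - 1)) \<and>
      cocycles C A n \<cdot> (c \<cdot> p) = diff A (n - 1) \<cdot> e)"
    (is "?L \<longleftrightarrow> ?R")
proof -
  define d m i q where "d = diff A (n - 1)" and "m = im_arr C (diff A (n - 1))"
    and "i = cocycles C A n" and "q = cohomology_proj C A n"
  define j where "j = lift_along C i m"
  have d: "d \<in> Arr C" "Dom C d = ob A (n - 1)" "Cod C d = ob A n" using A by (simp_all add: d_def)
  obtain e where e: "is_epi C e" "e \<in> Arr C" "Dom C e = ob A (n - 1)" "Cod C e = Dom C m" "m \<cdot> e = d"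
    using im_factor[OF d(1)] d unfolding m_def d_def by auto
  have m: "m \<in> Arr C" "is_mono C m" "Cod C m = ob A n"
    using im_arr[OF d(1)] d by (auto simp: m_def d_def)
  have i: "i \<in> Arr C" "Cod C i = ob A n" "is_mono C i"
    unfolding i_def by (rule cocycles_simps cocycles_mono)+
  have j: "j \<in> Arr C" "Dom C j = Dom C m" "Cod C j = Dom C i" "i \<cdot> j = m"
    using boundaries_cocycles[of n] by (auto simp: j_def m_def i_def)
  have coker: "is_cokernel C j q"
    using cohomology_proj_cokernel by (simp add: j_def m_def i_def q_def)
  note q = cokernelD[OF coker]
  have q3: "Dom C q = Dom C i" by (simp add: q_def i_def)
  have c: "c \<in> Arr C" "Cod C c = Dom C i" using c by (simp_all add: i_def)
  \<comment> \<open>\<open>j\<close> inherits being monic from \<open>i j = m\<close>.\<close>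
  have jmono: "is_mono C j"
  proof (rule monoI)
    fix x g assume g: "g \<in> Hom C x (Dom C j)" "j \<cdot> g = Zero C x (Cod C j)"
    have "m \<cdot> g = i \<cdot> (j \<cdot> g)" unfolding j(4)[symmetric] using j(1-3) i(1) g(1) by simp
    also have "\<dots> = Zero C x (Cod C m)" unfolding g(2) using j(1-3) i m(3) g(1) by auto
    finally show "g = Zero C x (Dom C j)" using mono_ZeroD[OF m(2), of g x] g(1) j(2) by simp
  qed (rule j)
  have "q \<cdot> c = Zero C (Dom C c) (Cod C q) \<longleftrightarrow>
    (\<exists>p e. is_epi C p \<and> Cod C p = Dom C c \<and> e \<in> Hom C (Dom C p) (ob A (n - 1)) \<and>
      i \<cdot> (c \<cdot> p) = d \<cdot> e)" (is "_ \<longleftrightarrow> ?R'")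
  proof
    assume "q \<cdot> c = Zero C (Dom C c) (Cod C q)"
    then obtain u where u: "u \<in> Hom C (Dom C c) (Dom C j)" "j \<cdot> u = c"
      using mono_factor_through[OF jmono coker c(1)] c(2) j(3) by metis
    have "Cod C u = Cod C e" "u \<in> Arr C" using u(1) j(2) e(4) by auto
    then obtain p v where pv: "is_epi C p" "Cod C p = Dom C u" "v \<in> Hom C (Dom C p) (Dom C e)" "e \<cdot> v = u \<cdot> p"
      using epi_pullback[OF e(1)] by metis
    have p: "p \<in> Arr C" using pv by simp
    have "i \<cdot> (c \<cdot> p) = (i \<cdot> j) \<cdot> (u \<cdot> p)"
      unfolding u(2)[symmetric] using u(1) p i(1) j(1-3) pv(2) by simp
    also have "\<dots> = (m \<cdot> e) \<cdot> v" 
      unfolding j(4) pv(4)[symmetric] using e(2-4) m(1) pv(3) by simp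
    finally show ?R'
      unfolding e(5) using pv(1-3) u(1) e(3) by auto
  next
    assume ?R'
    then obtain p x where p: "is_epi C p" "Cod C p = Dom C c" "x \<in> Hom C (Dom C p) (ob A (n - 1))"
      "i \<cdot> (c \<cdot> p) = d \<cdot> x" by blast
    have p': "p \<in> Arr C" using p by simp
    have "i \<cdot> (c \<cdot> p) = i \<cdot> (j \<cdot> (e \<cdot> x))"
      unfolding p(4) e(5)[symmetric] j(4)[symmetric] using p(3) e(2-4) j(1-3) i(1) by simp
    then have cp: "c \<cdot> p = j \<cdot> (e \<cdot> x)"
      by (rule monoD[OF i(3)]) (use p(2,3) p' c e(2-4) j(1-3) in simp_all)
    have "(q \<cdot> c) \<cdot> p = q \<cdot> (c \<cdot> p)" using p' p(2) c q(2) q3 by simp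
    also have "\<dots> = (q \<cdot> j) \<cdot> (e \<cdot> x)"
      unfolding cp using p(3) e(2-4) j(1-3) q(2) q3 by simp
    also have "\<dots> = Zero C (Dom C p) (Cod C q)"
      unfolding q(4) using p(3) e(2-4) j(1-3) q(2) by simp
    finally show "q \<cdot> c = Zero C (Dom C c) (Cod C q)"
      using epi_ZeroD[OF p(1), of "q \<cdot> c" "Cod C q"] p(2) c q(2) q3 by simp
  qed
  then show ?thesis by (simp add: i_def q_def d_def)
qed

lemma cohomology_proj_Comp_eq_ZeroI:
  assumes c: "c \<in> Arr C" "Cod C c = Dom C (cocycles C A n)"
    and e: "e \<in> Hom C (Dom C c) (ob A (n - 1))" "cocycles C A n \<cdot> c = diff A (n - 1) \<cdot> e"
  shows "cohomology_proj C A n \<cdot> c = Zero C (Dom C c) (Cod C (cohomology_proj C A n))"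
  unfolding cohomology_proj_Comp_eq_Zero_iff[OF c]
  by (intro exI[of _ "Id C (Dom C c)"] exI[of _ e]) (use c e in \<open>simp add: Id_epi\<close>)

end

section \<open>The map induced on cohomology and its generalised elements\<close>

context
  fixes f assumes f: "is_chain_map C f"
begin

lemma cocycles_map:
  "cocycles_map C f n \<in> Hom C (Dom C (cocycles C (src f) n)) (Dom C (cocycles C (tgt f) n))"
  "cocycles C (tgt f) n \<cdot> cocycles_map C f n = cmp f n \<cdot> cocycles C (src f) n"
proof -
  let ?i = "cocycles C (src f) n" and ?j = "cocycles C (tgt f) n"
  have "diff (tgt f) n \<cdot> (cmp f n \<cdot> ?i) = cmp f (n + 1) \<cdot> (diff (src f) n \<cdot> ?i)"
    using f by (simp add: chain_map_commute_comp del: cocycles_simps(3))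
  also have "\<dots> = Zero C (Dom C ?i) (ob (tgt f) (n + 1))" using f by simp
  finally obtain u where u: "u \<in> Hom C (Dom C ?i) (Dom C ?j)" "?j \<cdot> u = cmp f n \<cdot> ?i"
    using cocycles_lift[of "tgt f" "cmp f n \<cdot> ?i" n] f by auto
  then have "cocycles_map C f n = u"
    unfolding cocycles_map_def using f by (intro lift_along_eq) auto
  then show "cocycles_map C f n \<in> Hom C (Dom C ?i) (Dom C ?j)"
    "?j \<cdot> cocycles_map C f n = cmp f n \<cdot> ?i" using u by auto
qed

text \<open>The descent defining \<open>cohomology_map\<close> exists because a chain map sends
  boundaries to boundaries.\<close>

lemma cohomology_map:
  "cohomology_map C f n \<in> Hom C (Cod C (cohomology_proj C (src f) n)) (Cod C (cohomology_proj C (tgt f) n))"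
  "cohomology_map C f n \<cdot> cohomology_proj C (src f) n = cohomology_proj C (tgt f) n \<cdot> cocycles_map C f n"
proof -
  have A: "is_complex C (src f)" and B: "is_complex C (tgt f)" using f by auto
  define i j q r z where "i = cocycles C (src f) n" and "j = cocycles C (tgt f) n"
    and "q = cohomology_proj C (src f) n" and "r = cohomology_proj C (tgt f) n"
    and "z = cocycles_map C f n"
  define d m where "d = diff (src f) (n - 1)" and "m = im_arr C (diff (src f) (n - 1))"
  define s where "s = lift_along C i m"
  have d: "d \<in> Arr C" "Dom C d = ob (src f) (n - 1)" "Cod C d = ob (src f) n" using A by (simp_all add: d_def)
  obtain e where e: "is_epi C e" "e \<in> Arr C" "Dom C e = ob (src f) (n - 1)" "Cod C e = Dom C m" "m \<cdot> e = d"
    using im_factor[OF d(1)] d unfolding m_def d_def by auto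
  have i: "i \<in> Arr C" "Cod C i = ob (src f) n" and j: "j \<in> Arr C" "Cod C j = ob (tgt f) n"
    using A B by (simp_all add: i_def j_def)
  have s: "s \<in> Arr C" "Dom C s = Dom C m" "Cod C s = Dom C i" "i \<cdot> s = m"
    using boundaries_cocycles[OF A, of n] by (auto simp: s_def m_def i_def)
  have z: "z \<in> Arr C" "Dom C z = Dom C i" "Cod C z = Dom C j" "j \<cdot> z = cmp f n \<cdot> i"
    using cocycles_map[of n] by (auto simp: z_def i_def j_def)
  have r: "r \<in> Arr C" "Dom C r = Dom C j" using B by (auto simp: r_def j_def)
  have "j \<cdot> ((z \<cdot> s) \<cdot> e) = (j \<cdot> z) \<cdot> (s \<cdot> e)" using j z(1-3) s(1-3) e(2-4) by simp
  also have "\<dots> = cmp f n \<cdot> ((i \<cdot> s) \<cdot> e)"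
    unfolding z(4) using i s(1-3) e(2-4) f by simp
  also have "\<dots> = diff (tgt f) (n - 1) \<cdot> cmp f (n - 1)"
    unfolding s(4) e(5) d_def using f by (simp add: chain_map_commute)
  finally have jzs: "j \<cdot> ((z \<cdot> s) \<cdot> e) = diff (tgt f) (n - 1) \<cdot> cmp f (n - 1)" .
  have zs: "z \<cdot> s \<in> Arr C" "Cod C (z \<cdot> s) = Dom C j" "Dom C (z \<cdot> s) = Cod C e"
    using z(1-3) s(1-3) e(4) by simp_all
  moreover have "cmp f (n - 1) \<in> Hom C (Dom C e) (ob (tgt f) (n - 1))" using f e(3) by simp
  \<comment> \<open>The vanishing criterion is used with the epimorphism \<open>e\<close> onto the
    image and with \<open>cmp f (n - 1)\<close> as the preimage.\<close>
  ultimately have "r \<cdot> (z \<cdot> s) = Zero C (Dom C (z \<cdot> s)) (Cod C r)"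
    using cohomology_proj_Comp_eq_Zero_iff[OF B, of "z \<cdot> s" n, folded r_def j_def] jzs e(1) by metis
  then have "(r \<cdot> z) \<cdot> s = Zero C (Dom C s) (Cod C (r \<cdot> z))"
    using z(1-3) s(1-3) r by simp
  moreover have "is_cokernel C s q"
    using cohomology_proj_cokernel[OF A] by (simp add: s_def m_def i_def q_def)
  ultimately obtain u where u: "u \<in> Hom C (Cod C q) (Cod C (r \<cdot> z))" "u \<cdot> q = r \<cdot> z"
    using cokernel_descend[of s q "r \<cdot> z"] z(1-3) s(1-3) r by auto
  then have "cohomology_map C f n = u"
    unfolding cohomology_map_def q_def[symmetric] r_def[symmetric] z_def[symmetric]
    using A by (intro descend_along_eq) (auto simp: q_def)
  then show "cohomology_map C f n \<in> Hom C (Cod C (cohomology_proj C (src f) n)) (Cod C (cohomology_proj C (tgt f) n))"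
    "cohomology_map C f n \<cdot> cohomology_proj C (src f) n = cohomology_proj C (tgt f) n \<cdot> cocycles_map C f n"
    using u z(1-3) r by (auto simp: q_def[symmetric] r_def[symmetric] z_def[symmetric])
qed

text \<open>Isomorphism gives both conditions by transporting classes along the inverse
  \<open>g\<close>. Conversely \<open>coh_inj\<close> makes \<open>h\<close> monic and
  \<open>coh_surj\<close> makes it epic, which suffices in an abelian category.\<close>

lemma is_iso_cohomology_map_iff:
  "is_iso C (cohomology_map C f n) \<longleftrightarrow> coh_surj f n \<and> coh_inj f n"
proof -
  have A: "is_complex C (src f)" and B: "is_complex C (tgt f)" using f by auto
  define i j q r z h where "i = cocycles C (src f) n" and "j = cocycles C (tgt f) n"
    and "q = cohomology_proj C (src f) n" and "r = cohomology_proj C (tgt f) n"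
    and "z = cocycles_map C f n" and "h = cohomology_map C f n"
  have i: "i \<in> Arr C" "Cod C i = ob (src f) n" and j: "j \<in> Arr C" "Cod C j = ob (tgt f) n"
    and di: "diff (src f) n \<cdot> i = Zero C (Dom C i) (ob (src f) (n + 1))"
    and dj: "diff (tgt f) n \<cdot> j = Zero C (Dom C j) (ob (tgt f) (n + 1))"
    using A B by (simp_all add: i_def j_def)
  have z: "z \<in> Arr C" "Dom C z = Dom C i" "Cod C z = Dom C j" and jz: "j \<cdot> z = cmp f n \<cdot> i"
    using cocycles_map[of n] by (auto simp: z_def i_def j_def)
  have q: "q \<in> Arr C" "Dom C q = Dom C i" "is_epi C q" and r: "r \<in> Arr C" "Dom C r = Dom C j" "is_epi C r"
    using A B by (auto simp: r_def j_def q_def i_def)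
  have h: "h \<in> Arr C" "Dom C h = Cod C q" "Cod C h = Cod C r" and hq: "h \<cdot> q = r \<cdot> z"
    using cohomology_map[of n] by (auto simp: h_def q_def r_def z_def)
  note fs = chain_map_simps[OF f]
  note q_iff = cohomology_proj_Comp_eq_Zero_iff[OF A, where n=n, folded q_def i_def]
    and r_iff = cohomology_proj_Comp_eq_Zero_iff[OF B, where n=n, folded r_def j_def]
    and r_zeroI = cohomology_proj_Comp_eq_ZeroI[OF B, where n=n, folded r_def j_def]
  have jzx: "j \<cdot> (z \<cdot> x) = cmp f n \<cdot> (i \<cdot> x)" if "x \<in> Arr C" "Cod C x = Dom C i" for x
    using Comp_congL[OF jz, of x] that i j z fs by simp
  have hqx: "h \<cdot> (q \<cdot> x) = r \<cdot> (z \<cdot> x)" if "x \<in> Arr C" "Cod C x = Dom C i" for x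
    using Comp_congL[OF hq, of x] that q h r z by simp
  have "coh_surj f n \<and> coh_inj f n" if iso: "is_iso C h"
  proof -
    obtain g where g: "g \<in> Arr C" "Dom C g = Cod C r" "Cod C g = Cod C q"
      "g \<cdot> h = Id C (Cod C q)" "h \<cdot> g = Id C (Cod C r)"
      using iso h unfolding is_iso_def by auto
    have "coh_surj f n"
      unfolding coh_surj_def
    proof (intro ballI impI, elim conjE)
      fix x assume x: "x \<in> Arr C" "Cod C x = ob (tgt f) n" "diff (tgt f) n \<cdot> x = Zero C (Dom C x) (ob (tgt f) (n + 1))"
      obtain x' where x': "x' \<in> Arr C" "Dom C x' = Dom C x" "Cod C x' = Dom C j" "j \<cdot> x' = x"
        using cocycles_lift[OF B x] unfolding j_def by auto
      have "g \<cdot> (r \<cdot> x') \<in> Arr C" "Cod C (g \<cdot> (r \<cdot> x')) = Cod C q" "Dom C (g \<cdot> (r \<cdot> x')) = Dom C x"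
        using g(1-3) r x'(1-3) by simp_all
      \<comment> \<open>The class that \<open>g\<close> assigns to \<open>x\<close> is represented
        by a cocycle \<open>c\<close> only after composing with \<open>p\<close>, as
        \<open>q\<close> is merely epic.\<close>
      then obtain p c where p: "is_epi C p" "Cod C p = Dom C x"
        and c0: "c \<in> Hom C (Dom C p) (Dom C q)" and qc: "q \<cdot> c = (g \<cdot> (r \<cdot> x')) \<cdot> p"
        using epi_pullback[OF q(3)] by metis
      have c: "c \<in> Arr C" "Dom C c = Dom C p" "Cod C c = Dom C i" using c0 q(2) by simp_all
      have p': "p \<in> Arr C" using p by simp
      \<comment> \<open>The cocycle \<open>x\<close> minus the image of \<open>c\<close> has class
        zero, so it becomes a boundary after a second epimorphism \<open>p2\<close>.\<close>
      define w where "w = x' \<cdot> p \<oplus> \<ominus> (z \<cdot> c)"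
      have w: "w \<in> Arr C" "Dom C w = Dom C p" "Cod C w = Dom C j"
        unfolding w_def using x'(1-3) p(2) p' z c(1-3) by simp_all
      have "r \<cdot> (z \<cdot> c) = h \<cdot> (q \<cdot> c)" using hqx c(1-3) by simp
      also have "\<dots> = (h \<cdot> g) \<cdot> (r \<cdot> (x' \<cdot> p))"
        unfolding qc using h g(1-3) r x'(1-3) p' p(2) by simp
      also have "\<dots> = r \<cdot> (x' \<cdot> p)"
        unfolding g(5) using r x'(1-3) p' p(2) by simp
      finally have rr: "r \<cdot> (z \<cdot> c) = r \<cdot> (x' \<cdot> p)" .
      have "r \<cdot> w = r \<cdot> (x' \<cdot> p) \<oplus> \<ominus> (r \<cdot> (z \<cdot> c))"
        unfolding w_def using r x'(1-3) p(2) p' z c(1-3) by simp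
      also have "\<dots> = Zero C (Dom C w) (Cod C r)"
        unfolding rr using r x'(1-3) p(2) p' w by simp
      finally obtain p2 e where p2: "is_epi C p2" "Cod C p2 = Dom C w"
        and e: "e \<in> Arr C" "Dom C e = Dom C p2" "Cod C e = ob (tgt f) (n - 1)" "j \<cdot> (w \<cdot> p2) = diff (tgt f) (n - 1) \<cdot> e"
        using r_iff[OF w(1,3)] by auto
      have p2': "p2 \<in> Arr C" using p2 by simp
      have "diff (tgt f) (n - 1) \<cdot> e = (j \<cdot> x') \<cdot> (p \<cdot> p2) \<oplus> \<ominus> (j \<cdot> (z \<cdot> (c \<cdot> p2)))"
        unfolding e(4)[symmetric] w_def using x'(1-3) p p' z c(1-3) p2(2) p2' j w(2) by simp
      also have "\<dots> = x \<cdot> (p \<cdot> p2) \<oplus> \<ominus> (cmp f n \<cdot> (i \<cdot> (c \<cdot> p2)))"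
        unfolding x'(4) using c(1-3) p2(2) p2' w(2) by (subst jzx) simp_all
      finally have "x \<cdot> (p \<cdot> p2) = diff (tgt f) (n - 1) \<cdot> e \<oplus> cmp f n \<cdot> (i \<cdot> (c \<cdot> p2))"
        using x(1,2) p(2) p' p2(2) p2' w(2) c(1-3) i e(1-3) B fs
        by (subst Add_eq_iff[symmetric, where a="Dom C p2" and b="ob (tgt f) n"]) simp_all
      then have eq: "x \<cdot> (p \<cdot> p2) = cmp f n \<cdot> (i \<cdot> (c \<cdot> p2)) \<oplus> diff (tgt f) (n - 1) \<cdot> e"
        using p2(2) p2' w(2) c(1-3) i e(1-3) B fs by (subst Add_comm) simp_all
      have "diff (src f) n \<cdot> (i \<cdot> (c \<cdot> p2)) = Zero C (Dom C p2) (ob (src f) (n + 1))"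
        using Comp_congL[OF di, of "c \<cdot> p2"] i c(1-3) p2(2) p2' w(2) A by simp
      then show "\<exists>p c e. is_epi C p \<and> Cod C p = Dom C x \<and> c \<in> Hom C (Dom C p) (ob (src f) n) \<and>
          e \<in> Hom C (Dom C p) (ob (tgt f) (n - 1)) \<and>
          diff (src f) n \<cdot> c = Zero C (Dom C p) (ob (src f) (n + 1)) \<and>
          x \<cdot> p = cmp f n \<cdot> c \<oplus> diff (tgt f) (n - 1) \<cdot> e"
        using eq p p' p2 p2' w(2) c(1-3) i e(1-3)
        by (intro exI[of _ "p \<cdot> p2"] exI[of _ "i \<cdot> (c \<cdot> p2)"] exI[of _ e]) (simp add: epi_comp)
    qed
    moreover have "coh_inj f n"
      unfolding coh_inj_def
    proof (intro ballI impI, elim conjE)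
      fix x e assume x: "x \<in> Arr C" "Cod C x = ob (src f) n" "diff (src f) n \<cdot> x = Zero C (Dom C x) (ob (src f) (n + 1))"
        and e: "e \<in> Hom C (Dom C x) (ob (tgt f) (n - 1))" and fx: "cmp f n \<cdot> x = diff (tgt f) (n - 1) \<cdot> e"
      obtain x' where x': "x' \<in> Arr C" "Dom C x' = Dom C x" "Cod C x' = Dom C i" "i \<cdot> x' = x"
        using cocycles_lift[OF A x] unfolding i_def by auto
      have "j \<cdot> (z \<cdot> x') = diff (tgt f) (n - 1) \<cdot> e"
        using jzx[OF x'(1,3)] unfolding x'(4) fx .
      then have rz: "r \<cdot> (z \<cdot> x') = Zero C (Dom C x') (Cod C r)"
        using r_zeroI[of "z \<cdot> x'" e] e z x'(1-3) by simp
      \<comment> \<open>The class of \<open>x'\<close> is recovered from its image under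
        \<open>h\<close>, and that image is zero because \<open>x\<close> maps to a
        boundary.\<close>
      have "q \<cdot> x' = (g \<cdot> h) \<cdot> (q \<cdot> x')"
        unfolding g(4) using q x'(1-3) by simp
      also have "\<dots> = g \<cdot> (r \<cdot> (z \<cdot> x'))"
        using hqx[OF x'(1,3)] g(1-3) h q x'(1-3) by simp
      also have "\<dots> = Zero C (Dom C x') (Cod C q)"
        unfolding rz using g(1-3) x'(1) by simp
      finally obtain p e' where "is_epi C p" "Cod C p = Dom C x'" "e' \<in> Hom C (Dom C p) (ob (src f) (n - 1))"
        "i \<cdot> (x' \<cdot> p) = diff (src f) (n - 1) \<cdot> e'"
        using q_iff[OF x'(1,3)] by blast
      moreover from this have "i \<cdot> (x' \<cdot> p) = x \<cdot> p"
        unfolding x'(4)[symmetric] using i x'(1-3) by simp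
      ultimately show "\<exists>p e'. is_epi C p \<and> Cod C p = Dom C x \<and> e' \<in> Hom C (Dom C p) (ob (src f) (n - 1)) \<and>
          x \<cdot> p = diff (src f) (n - 1) \<cdot> e'"
        using x'(2) by metis
    qed
    ultimately show ?thesis ..
  qed
  moreover have "is_iso C h" if surj: "coh_surj f n" and inj: "coh_inj f n"
  proof (rule mono_epi_iso)
    show "is_mono C h"
    proof (rule monoI)
      fix x g assume g: "g \<in> Hom C x (Dom C h)" "h \<cdot> g = Zero C x (Cod C h)"
      obtain p c where p: "is_epi C p" "Cod C p = x"
        and c0: "c \<in> Hom C (Dom C p) (Dom C q)" and qc: "q \<cdot> c = g \<cdot> p"
        using epi_pullback[OF q(3), of g] g(1) h(2) by (metis Hom_iff)
      have c: "c \<in> Arr C" "Dom C c = Dom C p" "Cod C c = Dom C i" using c0 q(2) by simp_all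
      have p': "p \<in> Arr C" using p by simp
      have "r \<cdot> (z \<cdot> c) = h \<cdot> (q \<cdot> c)" using hqx c(1-3) by simp
      also have "\<dots> = (h \<cdot> g) \<cdot> p" unfolding qc using h g(1) p(2) p' by simp
      also have "\<dots> = Zero C (Dom C (z \<cdot> c)) (Cod C r)" unfolding g(2) using r(1) h g(1) p(2) p' z c(1-3) by simp
      finally obtain p2 e where p2: "is_epi C p2" "Cod C p2 = Dom C (z \<cdot> c)"
        and e: "e \<in> Hom C (Dom C p2) (ob (tgt f) (n - 1))" "j \<cdot> ((z \<cdot> c) \<cdot> p2) = diff (tgt f) (n - 1) \<cdot> e"
        using r_iff[of "z \<cdot> c"] z c(1-3) by auto
      have p2': "p2 \<in> Arr C" "Cod C p2 = Dom C p" using p2 z c(1-3) by simp_all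
      \<comment> \<open>\<open>y\<close> is a cocycle representing \<open>g\<close> along
        \<open>p\<close> and \<open>p2\<close>, and its image under \<open>f\<close> is the boundary
        of \<open>e\<close>. Injectivity kills its class, after which the epimorphisms
        cancel.\<close>
      define y where "y = i \<cdot> (c \<cdot> p2)"
      have y: "y \<in> Arr C" "Dom C y = Dom C p2" "Cod C y = ob (src f) n"
        unfolding y_def using i c(1-3) p2' by simp_all
      have "diff (src f) n \<cdot> y = Zero C (Dom C y) (ob (src f) (n + 1))"
        unfolding y_def using Comp_congL[OF di, of "c \<cdot> p2"] i c(1-3) p2' A by simp
      moreover have "cmp f n \<cdot> y = diff (tgt f) (n - 1) \<cdot> e"
        unfolding y_def e(2)[symmetric] using jzx[of "c \<cdot> p2"] z c(1-3) p2' by simp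
      moreover have "e \<in> Hom C (Dom C y) (ob (tgt f) (n - 1))" using e(1) y(2) by simp
      ultimately obtain p3 e' where p3: "is_epi C p3" "Cod C p3 = Dom C y"
        and e': "e' \<in> Hom C (Dom C p3) (ob (src f) (n - 1))" "y \<cdot> p3 = diff (src f) (n - 1) \<cdot> e'"
        using inj y(1,3) unfolding coh_inj_def by blast
      have p3': "p3 \<in> Arr C" using p3 by simp
      have "i \<cdot> ((c \<cdot> p2) \<cdot> p3) = diff (src f) (n - 1) \<cdot> e'"
        unfolding e'(2)[symmetric] y_def using i c(1-3) p2' p3' p3(2) y(2) by simp
      moreover have "c \<cdot> p2 \<in> Arr C" "Cod C (c \<cdot> p2) = Dom C i" "Dom C (c \<cdot> p2) = Dom C y"
        using c(1-3) p2' y by simp_all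
      ultimately have "q \<cdot> (c \<cdot> p2) = Zero C (Dom C p2) (Cod C q)"
        using q_iff[of "c \<cdot> p2"] p3 e'(1) y(2) by auto
      moreover have "(g \<cdot> p) \<cdot> p2 = q \<cdot> (c \<cdot> p2)"
        unfolding qc[symmetric] using q c(1-3) p2' by simp
      ultimately have "g \<cdot> (p \<cdot> p2) = Zero C (Dom C (p \<cdot> p2)) (Cod C q)"
        using g(1) p(2) p' p2' by simp
      moreover have "is_epi C (p \<cdot> p2)" by (rule epi_comp) (use p p2 p2' in auto)
      ultimately show "g = Zero C x (Dom C h)"
        using epi_ZeroD[of "p \<cdot> p2" g "Cod C q"] g(1) p(2) p' p2' h by simp
    qed (rule h)
    show "is_epi C h"
    proof (rule epiI)
      fix x g assume g: "g \<in> Hom C (Cod C h) x" "g \<cdot> h = Zero C (Dom C h) x"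
      \<comment> \<open>Surjectivity is applied to the universal cocycle, namely the inclusion
        \<open>j\<close> itself.\<close>
      obtain p c e where p: "is_epi C p" "Cod C p = Dom C j"
        and c: "c \<in> Hom C (Dom C p) (ob (src f) n)" "diff (src f) n \<cdot> c = Zero C (Dom C p) (ob (src f) (n + 1))"
        and e: "e \<in> Hom C (Dom C p) (ob (tgt f) (n - 1))"
        and eq: "j \<cdot> p = cmp f n \<cdot> c \<oplus> diff (tgt f) (n - 1) \<cdot> e"
        using surj j dj unfolding coh_surj_def by blast
      have p': "p \<in> Arr C" using p by simp
      obtain c' where c': "c' \<in> Arr C" "Dom C c' = Dom C p" "Cod C c' = Dom C i" "i \<cdot> c' = c"
        using cocycles_lift[OF A, of c n] c unfolding i_def by auto
      define w where "w = p \<oplus> \<ominus> (z \<cdot> c')"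
      have w: "w \<in> Arr C" "Dom C w = Dom C p" "Cod C w = Dom C j"
        unfolding w_def using p(2) p' z c'(1-3) by simp_all
      have "j \<cdot> w = j \<cdot> p \<oplus> \<ominus> (j \<cdot> (z \<cdot> c'))"
        unfolding w_def using p(2) p' z c'(1-3) j by simp
      also have "\<dots> = (cmp f n \<cdot> c \<oplus> diff (tgt f) (n - 1) \<cdot> e) \<oplus> \<ominus> (cmp f n \<cdot> c)"
        unfolding eq jzx[OF c'(1,3)] c'(4) ..
      also have "\<dots> = (diff (tgt f) (n - 1) \<cdot> e \<oplus> cmp f n \<cdot> c) \<oplus> \<ominus> (cmp f n \<cdot> c)"
        using c(1) e B fs by (subst Add_comm) simp_all
      also have "\<dots> = diff (tgt f) (n - 1) \<cdot> e"
        using c(1) e B fs by simp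
      finally have rw: "r \<cdot> w = Zero C (Dom C p) (Cod C r)"
        using r_zeroI[of w e] w e by simp
      \<comment> \<open>Modulo boundaries \<open>p\<close> agrees with \<open>z c'\<close>, whose
        class lies in the image of \<open>h\<close> and is therefore killed by \<open>g\<close>.
        Then \<open>p\<close> and \<open>r\<close> cancel in turn.\<close>
      have "(g \<cdot> r) \<cdot> p = (g \<cdot> r) \<cdot> (w \<oplus> z \<cdot> c')"
        unfolding w_def using p(2) p' z c'(1-3) by simp
      also have "\<dots> = g \<cdot> (r \<cdot> w) \<oplus> g \<cdot> (r \<cdot> (z \<cdot> c'))"
        using g(1) h r w z c'(1-3) by simp
      also have "\<dots> = g \<cdot> (r \<cdot> w) \<oplus> (g \<cdot> h) \<cdot> (q \<cdot> c')"
        unfolding hqx[OF c'(1,3), symmetric] using g(1) h q c'(1-3) by simp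
      also have "\<dots> = Zero C (Dom C p) x"
        unfolding rw g(2) using g(1) h q c'(1-3) p' r by auto
      finally have "g \<cdot> r = Zero C (Cod C p) x"
        using epi_ZeroD[OF p(1), of "g \<cdot> r" x] g(1) h r p(2) by simp
      then show "g = Zero C (Cod C h) x"
        using epi_ZeroD[OF r(3), of g x] g(1) h r p(2) by simp
    qed (rule h)
  qed
  ultimately show ?thesis unfolding h_def by blast
qed

end

end

section \<open>Homotopies\<close>

context preadditive_category
begin

text \<open>The identity is solved for \<open>cmp g i\<close>, so that it can be substituted
  directly without handling differences.\<close>

lemma homotopy_relI:
  assumes f: "is_chain_map C f" and g: "is_chain_map C g" and fg: "src g = src f" "tgt g = tgt f"
    and k: "\<And>i. k i \<in> Hom C (ob (src f) i) (ob (tgt f) (i - 1))"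
    and eq: "\<And>i. cmp g i = (diff (tgt f) (i - 1) \<cdot> k i \<oplus> k (i + 1) \<cdot> diff (src f) i) \<oplus> cmp f i"
  shows "(f, g) \<in> homotopy_rel C"
proof -
  have "is_homotopy C f g k"
    unfolding is_homotopy_def Minus_eq
  proof (intro allI conjI k)
    fix i
    show "cmp g i \<oplus> \<ominus> cmp f i = diff (tgt f) (i - 1) \<cdot> k i \<oplus> k (i + 1) \<cdot> diff (src f) i"
      using f g fg k[of i] k[of "i + 1"] eq[of i]
      by (subst Add_eq_iff[where a="ob (src f) i" and b="ob (tgt f) i"]) simp_all
  qed
  then show ?thesis using f g fg by (auto simp: homotopy_rel_def)
qed

lemma homotopy_relE:
  assumes "(f, g) \<in> homotopy_rel C"
  obtains k where "is_chain_map C f" "is_chain_map C g" "src g = src f" "tgt g = tgt f"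
    "\<And>i. k i \<in> Hom C (ob (src f) i) (ob (tgt f) (i - 1))"
    "\<And>i. cmp g i = (diff (tgt f) (i - 1) \<cdot> k i \<oplus> k (i + 1) \<cdot> diff (src f) i) \<oplus> cmp f i"
proof -
  from assms obtain k where *: "is_chain_map C f" "is_chain_map C g" "src g = src f" "tgt g = tgt f"
    and h: "is_homotopy C f g k"
    unfolding homotopy_rel_def by auto
  have k: "k i \<in> Hom C (ob (src f) i) (ob (tgt f) (i - 1))" for i
    using h unfolding is_homotopy_def by blast
  have "cmp g i = (diff (tgt f) (i - 1) \<cdot> k i \<oplus> k (i + 1) \<cdot> diff (src f) i) \<oplus> cmp f i" for i
  proof -
    have "cmp g i \<oplus> \<ominus> cmp f i = diff (tgt f) (i - 1) \<cdot> k i \<oplus> k (i + 1) \<cdot> diff (src f) i"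
      using h unfolding is_homotopy_def Minus_eq by blast
    then show ?thesis
      using * k[of i] k[of "i + 1"]
      by (subst (asm) Add_eq_iff[where a="ob (src f) i" and b="ob (tgt f) i"]) simp_all
  qed
  with * k that show ?thesis by blast
qed

lemma homotopy_rel_refl:
  assumes f: "is_chain_map C f"
  shows "(f, f) \<in> homotopy_rel C"
  by (rule homotopy_relI[OF f f refl refl, of "\<lambda>i. Zero C (ob (src f) i) (ob (tgt f) (i - 1))"])
    (use f in simp_all)

lemma homotopy_rel_sym:
  assumes "(f, g) \<in> homotopy_rel C"
  shows "(g, f) \<in> homotopy_rel C"
proof -
  obtain k where f: "is_chain_map C f" and g: "is_chain_map C g" and fg: "src g = src f" "tgt g = tgt f"
    and k: "\<And>i. k i \<in> Hom C (ob (src f) i) (ob (tgt f) (i - 1))"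
    and eq: "\<And>i. cmp g i = (diff (tgt f) (i - 1) \<cdot> k i \<oplus> k (i + 1) \<cdot> diff (src f) i) \<oplus> cmp f i"
    using homotopy_relE[OF assms] by metis
  show ?thesis
  proof (rule homotopy_relI[OF g f fg[symmetric], of "\<lambda>i. \<ominus> k i"])
    show "\<ominus> k i \<in> Hom C (ob (src g) i) (ob (tgt g) (i - 1))" for i using k[of i] fg by simp
    fix i
    define h where "h = diff (tgt f) (i - 1) \<cdot> k i \<oplus> k (i + 1) \<cdot> diff (src f) i"
    have h: "h \<in> Arr C" "Dom C h = ob (src f) i" "Cod C h = ob (tgt f) i"
      unfolding h_def using f k[of i] k[of "i + 1"] by simp_all
    have "diff (tgt g) (i - 1) \<cdot> \<ominus> k i \<oplus> \<ominus> k (i + 1) \<cdot> diff (src g) i = \<ominus> h"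
      unfolding h_def fg using f k[of i] k[of "i + 1"] by simp
    moreover have "\<ominus> h \<oplus> (h \<oplus> cmp f i) = cmp f i" using h f by simp
    ultimately show "cmp f i = (diff (tgt g) (i - 1) \<cdot> \<ominus> k i \<oplus> \<ominus> k (i + 1) \<cdot> diff (src g) i) \<oplus> cmp g i"
      unfolding eq h_def[symmetric] by simp
  qed
qed

lemma homotopy_rel_trans:
  assumes "(f, g) \<in> homotopy_rel C" "(g, h) \<in> homotopy_rel C"
  shows "(f, h) \<in> homotopy_rel C"
proof -
  obtain k where f: "is_chain_map C f" and fg: "src g = src f" "tgt g = tgt f"
    and k: "\<And>i. k i \<in> Hom C (ob (src f) i) (ob (tgt f) (i - 1))"
    and eq: "\<And>i. cmp g i = (diff (tgt f) (i - 1) \<cdot> k i \<oplus> k (i + 1) \<cdot> diff (src f) i) \<oplus> cmp f i"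
    using homotopy_relE[OF assms(1)] by metis
  obtain l where h: "is_chain_map C h" and gh: "src h = src g" "tgt h = tgt g"
    and l: "\<And>i. l i \<in> Hom C (ob (src g) i) (ob (tgt g) (i - 1))"
    and eq': "\<And>i. cmp h i = (diff (tgt g) (i - 1) \<cdot> l i \<oplus> l (i + 1) \<cdot> diff (src g) i) \<oplus> cmp g i"
    using homotopy_relE[OF assms(2)] by metis
  show ?thesis
  proof (rule homotopy_relI[OF f h, of "\<lambda>i. k i \<oplus> l i"])
    show "src h = src f" "tgt h = tgt f" using fg gh by simp_all
    show "k i \<oplus> l i \<in> Hom C (ob (src f) i) (ob (tgt f) (i - 1))" for i
      using k[of i] l[of i] fg by simp
    show "cmp h i = (diff (tgt f) (i - 1) \<cdot> (k i \<oplus> l i) \<oplus> (k (i + 1) \<oplus> l (i + 1)) \<cdot> diff (src f) i) \<oplus> cmp f i"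
      for i
      unfolding eq' eq fg using f k[of i] l[of i] k[of "i + 1"] l[of "i + 1"] fg
      by (simp add: Add_comm Add_lcomm)
  qed
qed

section \<open>Composition of chain maps up to homotopy\<close>

abbreviation chain_comp where "chain_comp g f \<equiv> g \<cdot>\<^bsub>complex_category C\<^esub> f"

lemma chain_comp_simps [simp]:
  "src (chain_comp g f) = src f" "tgt (chain_comp g f) = tgt g" "cmp (chain_comp g f) i = cmp g i \<cdot> cmp f i"
  by (simp_all add: complex_category_def)

lemma chain_map_chain_comp:
  assumes f: "is_chain_map C f" and g: "is_chain_map C g" and fg: "src g = tgt f"
  shows "is_chain_map C (chain_comp g f)"
  unfolding is_chain_map_def chain_comp_simps
proof (intro conjI allI)
  fix i
  have "diff (tgt g) i \<cdot> (cmp g i \<cdot> cmp f i) = cmp g (i + 1) \<cdot> (diff (src g) i \<cdot> cmp f i)"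
    using f g fg by (subst chain_map_commute_comp) simp_all
  also have "\<dots> = cmp g (i + 1) \<cdot> (cmp f (i + 1) \<cdot> diff (src f) i)"
    using chain_map_commute[OF f refl, of i] fg by simp
  finally show "diff (tgt g) i \<cdot> (cmp g i \<cdot> cmp f i) = cmp g (i + 1) \<cdot> cmp f (i + 1) \<cdot> diff (src f) i"
    using f g fg by simp
qed (use f g fg in simp_all)

text \<open>One factor is replaced at a time: composing \<open>k\<close> with \<open>g\<close> is a
  homotopy from \<open>g f\<close> to \<open>g f'\<close>, and composing \<open>l\<close> with
  \<open>f'\<close> is one from \<open>g f'\<close> to \<open>g' f'\<close>.\<close>

lemma homotopy_rel_chain_comp:
  assumes "(f, f') \<in> homotopy_rel C" "(g, g') \<in> homotopy_rel C" "src g = tgt f"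
  shows "(chain_comp g f, chain_comp g' f') \<in> homotopy_rel C"
proof -
  obtain k where f: "is_chain_map C f" and f': "is_chain_map C f'" and ff: "src f' = src f" "tgt f' = tgt f"
    and k: "\<And>i. k i \<in> Hom C (ob (src f) i) (ob (tgt f) (i - 1))"
    and eq: "\<And>i. cmp f' i = (diff (tgt f) (i - 1) \<cdot> k i \<oplus> k (i + 1) \<cdot> diff (src f) i) \<oplus> cmp f i"
    using homotopy_relE[OF assms(1)] by metis
  obtain l where g: "is_chain_map C g" and g': "is_chain_map C g'" and gg: "src g' = src g" "tgt g' = tgt g"
    and l: "\<And>i. l i \<in> Hom C (ob (src g) i) (ob (tgt g) (i - 1))"
    and eq': "\<And>i. cmp g' i = (diff (tgt g) (i - 1) \<cdot> l i \<oplus> l (i + 1) \<cdot> diff (src g) i) \<oplus> cmp g i"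
    using homotopy_relE[OF assms(2)] by metis
  have "(chain_comp g f, chain_comp g f') \<in> homotopy_rel C"
  proof (rule homotopy_relI[where k="\<lambda>i. cmp g (i - 1) \<cdot> k i"], goal_cases)
    \<comment> \<open>The sixth premise of \<open>homotopy_relI\<close> is the homotopy identity;
      the first five only concern types.\<close>
    case (6 i)
    have "cmp g i \<cdot> (diff (src g) (i - 1) \<cdot> k i) = diff (tgt g) (i - 1) \<cdot> (cmp g (i - 1) \<cdot> k i)"
      using g k[of i] assms(3) by (intro chain_map_commute_comp) simp_all
    then show ?case
      unfolding chain_comp_simps eq using f g k[of i] k[of "i + 1"] assms(3) by simp
  qed (use f f' g ff k assms(3) in \<open>simp_all add: chain_map_chain_comp\<close>)
  moreover have "(chain_comp g f', chain_comp g' f') \<in> homotopy_rel C"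
  proof (rule homotopy_relI[where k="\<lambda>i. l i \<cdot> cmp f' i"], goal_cases)
    case (6 i)
    have "cmp f' (i + 1) \<cdot> diff (src f') i = diff (src g) i \<cdot> cmp f' i"
      using chain_map_commute[OF f' refl, of i] ff assms(3) by simp
    then show ?case
      unfolding chain_comp_simps eq' using f f' g l[of i] l[of "i + 1"] ff assms(3) by simp
  qed (use f f' g g' ff gg l assms(3) in \<open>simp_all add: chain_map_chain_comp\<close>)
  ultimately show ?thesis by (rule homotopy_rel_trans)
qed

text \<open>On a cocycle \<open>c\<close> the two maps differ by the boundary of \<open>k c\<close>,
  so the same \<open>c\<close> serves and only the boundary term changes, by
  \<open>- k c\<close>.\<close>

lemma coh_surj_homotopic:
  assumes "(f, g) \<in> homotopy_rel C" "coh_surj f n"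
  shows "coh_surj g n"
proof -
  obtain k where f: "is_chain_map C f" and fg: "src g = src f" "tgt g = tgt f"
    and k: "\<And>i. k i \<in> Hom C (ob (src f) i) (ob (tgt f) (i - 1))"
    and eq: "\<And>i. cmp g i = (diff (tgt f) (i - 1) \<cdot> k i \<oplus> k (i + 1) \<cdot> diff (src f) i) \<oplus> cmp f i"
    using homotopy_relE[OF assms(1)] by metis
  show ?thesis
    unfolding coh_surj_def
  proof (intro ballI impI, elim conjE)
    fix z assume "z \<in> Arr C" "Cod C z = ob (tgt g) n" "diff (tgt g) n \<cdot> z = Zero C (Dom C z) (ob (tgt g) (n + 1))"
    then obtain p c e where p: "is_epi C p" "Cod C p = Dom C z"
      and c: "c \<in> Hom C (Dom C p) (ob (src f) n)" and e: "e \<in> Hom C (Dom C p) (ob (tgt f) (n - 1))"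
      and dc: "diff (src f) n \<cdot> c = Zero C (Dom C p) (ob (src f) (n + 1))"
      and zp: "z \<cdot> p = cmp f n \<cdot> c \<oplus> diff (tgt f) (n - 1) \<cdot> e"
      using assms(2) unfolding coh_surj_def fg by blast
    have "cmp g n \<cdot> c = diff (tgt f) (n - 1) \<cdot> (k n \<cdot> c) \<oplus> cmp f n \<cdot> c"
      unfolding eq using epi_Arr[OF p(1)] dc c f k[of n] k[of "n + 1"] by simp
    also have "\<dots> = cmp f n \<cdot> c \<oplus> diff (tgt f) (n - 1) \<cdot> (k n \<cdot> c)"
      using c f k[of n] by (intro Add_comm) simp_all
    finally have "z \<cdot> p = cmp g n \<cdot> c \<oplus> diff (tgt g) (n - 1) \<cdot> (\<ominus> (k n \<cdot> c) \<oplus> e)"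
      unfolding zp fg using c e f k[of n] by simp
    then show "\<exists>p c e. is_epi C p \<and> Cod C p = Dom C z \<and> c \<in> Hom C (Dom C p) (ob (src g) n) \<and>
        e \<in> Hom C (Dom C p) (ob (tgt g) (n - 1)) \<and>
        diff (src g) n \<cdot> c = Zero C (Dom C p) (ob (src g) (n + 1)) \<and>
        z \<cdot> p = cmp g n \<cdot> c \<oplus> diff (tgt g) (n - 1) \<cdot> e"
      using p c e dc fg k[of n]
      by (intro exI[of _ p] exI[of _ c] exI[of _ "\<ominus> (k n \<cdot> c) \<oplus> e"]) simp
  qed
qed

text \<open>If \<open>g z\<close> is the boundary of \<open>e\<close>, then \<open>f z\<close> is
  the boundary of \<open>e - k z\<close>, because \<open>z\<close> is a cocycle.\<close>

lemma coh_inj_homotopic: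
  assumes "(f, g) \<in> homotopy_rel C" "coh_inj f n"
  shows "coh_inj g n"
proof -
  obtain k where f: "is_chain_map C f" and fg: "src g = src f" "tgt g = tgt f"
    and k: "\<And>i. k i \<in> Hom C (ob (src f) i) (ob (tgt f) (i - 1))"
    and eq: "\<And>i. cmp g i = (diff (tgt f) (i - 1) \<cdot> k i \<oplus> k (i + 1) \<cdot> diff (src f) i) \<oplus> cmp f i"
    using homotopy_relE[OF assms(1)] by metis
  show ?thesis
    unfolding coh_inj_def fg
  proof (intro ballI impI, elim conjE)
    fix z e assume z: "z \<in> Arr C" "Cod C z = ob (src f) n" "diff (src f) n \<cdot> z = Zero C (Dom C z) (ob (src f) (n + 1))"
      and e: "e \<in> Hom C (Dom C z) (ob (tgt f) (n - 1))" and gz: "cmp g n \<cdot> z = diff (tgt f) (n - 1) \<cdot> e"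
    have "cmp g n \<cdot> z = diff (tgt f) (n - 1) \<cdot> (k n \<cdot> z) \<oplus> cmp f n \<cdot> z"
      unfolding eq using z f k[of n] k[of "n + 1"] by simp
    then have "\<ominus> (diff (tgt f) (n - 1) \<cdot> (k n \<cdot> z)) \<oplus> diff (tgt f) (n - 1) \<cdot> e = cmp f n \<cdot> z"
      unfolding gz[symmetric] using z f k[of n] by simp
    then have fz: "cmp f n \<cdot> z = diff (tgt f) (n - 1) \<cdot> (\<ominus> (k n \<cdot> z) \<oplus> e)"
      using z e f k[of n] by simp
    have "\<ominus> (k n \<cdot> z) \<oplus> e \<in> Hom C (Dom C z) (ob (tgt f) (n - 1))"
      using z e k[of n] by simp
    with z fz assms(2) show "\<exists>p e'. is_epi C p \<and> Cod C p = Dom C z \<and>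
        e' \<in> Hom C (Dom C p) (ob (src f) (n - 1)) \<and> z \<cdot> p = diff (src f) (n - 1) \<cdot> e'"
      unfolding coh_inj_def by blast
  qed
qed

section \<open>Arrows of the homotopy category via representatives\<close>

lemma homotopy_class_eqI: "(f, g) \<in> homotopy_rel C \<Longrightarrow> homotopy_rel C `` {f} = homotopy_rel C `` {g}"
  by (auto intro: homotopy_rel_sym homotopy_rel_trans)

text \<open>Homotopic maps share source and target, so the sets fed to \<open>the_elem\<close> are
  singletons.\<close>

lemma homotopy_category_Hom_iff:
  "F \<in> Hom (homotopy_category C) A B \<longleftrightarrow>
    (\<exists>f. is_chain_map C f \<and> src f = A \<and> tgt f = B \<and> F = homotopy_rel C `` {f})"
proof -
  have *: "the_elem (src ` (homotopy_rel C `` {f})) = src f" "the_elem (tgt ` (homotopy_rel C `` {f})) = tgt f"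
    if f: "is_chain_map C f" for f
  proof -
    have "src ` (homotopy_rel C `` {f}) = {src f}" "tgt ` (homotopy_rel C `` {f}) = {tgt f}"
      using homotopy_rel_refl[OF f] by (auto simp: homotopy_rel_def image_iff)
    then show "the_elem (src ` (homotopy_rel C `` {f})) = src f" "the_elem (tgt ` (homotopy_rel C `` {f})) = tgt f"
      by simp_all
  qed
  show ?thesis
    by (auto simp: homotopy_category_def complex_category_def quotient_def *)
qed

text \<open>The defined composite saturates the set of all products of representatives;
  compatibility of homotopy with composition puts these in a single class.\<close>

lemma homotopy_category_Comp:
  assumes f: "is_chain_map C f" and g: "is_chain_map C g" and fg: "src g = tgt f"
  shows "homotopy_rel C `` {g} \<cdot>\<^bsub>homotopy_category C\<^esub> homotopy_rel C `` {f} = homotopy_rel C `` {chain_comp g f}"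
proof -
  let ?S = "{g' \<cdot>\<^bsub>complex_category C\<^esub> f' | g' f'. g' \<in> homotopy_rel C `` {g} \<and> f' \<in> homotopy_rel C `` {f}}"
  have "homotopy_rel C `` ?S = homotopy_rel C `` {chain_comp g f}"
  proof
    show "homotopy_rel C `` ?S \<subseteq> homotopy_rel C `` {chain_comp g f}"
    proof
      fix h assume "h \<in> homotopy_rel C `` ?S"
      then obtain g' f' where "(g, g') \<in> homotopy_rel C" "(f, f') \<in> homotopy_rel C"
        "(chain_comp g' f', h) \<in> homotopy_rel C" by blast
      then show "h \<in> homotopy_rel C `` {chain_comp g f}"
        using homotopy_rel_chain_comp[of f f' g g'] homotopy_rel_trans fg by blast
    qed
    show "homotopy_rel C `` {chain_comp g f} \<subseteq> homotopy_rel C `` ?S"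
      using homotopy_rel_refl[OF f] homotopy_rel_refl[OF g] by blast
  qed
  then show ?thesis by (simp add: homotopy_category_def)
qed

end

text \<open>Homotopy invariance of \<open>coh_surj\<close> and \<open>coh_inj\<close> carries the
  test from one representative to all those that \<open>quasi_iso\<close> quantifies over.\<close>

lemma (in abelian_category) quasi_iso_class_iff:
  assumes f: "is_chain_map C f"
  shows "quasi_iso C (homotopy_rel C `` {f}) \<longleftrightarrow> (\<forall>n. coh_surj f n \<and> coh_inj f n)"
proof
  assume "quasi_iso C (homotopy_rel C `` {f})"
  then have "quasi_iso_chain_map C f"
    using homotopy_rel_refl[OF f] unfolding quasi_iso_def by blast
  then show "\<forall>n. coh_surj f n \<and> coh_inj f n"
    by (simp add: quasi_iso_chain_map_def is_iso_cohomology_map_iff f)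
next
  assume *: "\<forall>n. coh_surj f n \<and> coh_inj f n"
  have "homotopy_rel C `` {f} \<in> Hom (homotopy_category C) (src f) (tgt f)"
    using f unfolding homotopy_category_Hom_iff by blast
  moreover have "quasi_iso_chain_map C g" if g: "(f, g) \<in> homotopy_rel C" for g
  proof -
    have "is_chain_map C g" using g by (simp add: homotopy_rel_def)
    then show ?thesis
      using * coh_surj_homotopic[OF g] coh_inj_homotopic[OF g]
      by (simp add: quasi_iso_chain_map_def is_iso_cohomology_map_iff)
  qed
  ultimately show "quasi_iso C (homotopy_rel C `` {f})"
    by (simp add: quasi_iso_def)
qed

section \<open>The homotopy fibre\<close>

context abelian_category
begin

text \<open>Existence and joint cancellation are separate clauses because they have separate uses:
  the first builds the differential and the elements of the fibre, the second checks equations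
  componentwise.\<close>

definition is_triple_product :: "'o \<Rightarrow> 'o \<Rightarrow> 'o \<Rightarrow> 'o \<Rightarrow> 'm \<Rightarrow> 'm \<Rightarrow> 'm \<Rightarrow> bool" where
  "is_triple_product a b c p p1 p2 p3 \<longleftrightarrow> p1 \<in> Hom C p a \<and> p2 \<in> Hom C p b \<and> p3 \<in> Hom C p c \<and>
    (\<forall>x. \<forall>f \<in> Hom C x a. \<forall>g \<in> Hom C x b. \<forall>h \<in> Hom C x c.
      \<exists>u. u \<in> Hom C x p \<and> p1 \<cdot> u = f \<and> p2 \<cdot> u = g \<and> p3 \<cdot> u = h) \<and>
    (\<forall>x. \<forall>u \<in> Hom C x p. \<forall>v \<in> Hom C x p. p1 \<cdot> u = p1 \<cdot> v \<longrightarrow> p2 \<cdot> u = p2 \<cdot> v \<longrightarrow> p3 \<cdot> u = p3 \<cdot> v \<longrightarrow> u = v)"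

lemma is_triple_productD:
  assumes "is_triple_product a b c p p1 p2 p3"
  shows "p1 \<in> Hom C p a" "p2 \<in> Hom C p b" "p3 \<in> Hom C p c"
    and "f \<in> Hom C x a \<Longrightarrow> g \<in> Hom C x b \<Longrightarrow> h \<in> Hom C x c \<Longrightarrow>
      \<exists>u. u \<in> Hom C x p \<and> p1 \<cdot> u = f \<and> p2 \<cdot> u = g \<and> p3 \<cdot> u = h"
    and "u \<in> Hom C x p \<Longrightarrow> v \<in> Hom C x p \<Longrightarrow> p1 \<cdot> u = p1 \<cdot> v \<Longrightarrow> p2 \<cdot> u = p2 \<cdot> v \<Longrightarrow> p3 \<cdot> u = p3 \<cdot> v \<Longrightarrow> u = v"
  using assms unfolding is_triple_product_def by blast+

text \<open>The product is iterated: \<open>p\<close> is a product of \<open>d\<close> and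
  \<open>c\<close>, where \<open>d\<close> is a product of \<open>a\<close> and
  \<open>b\<close>.\<close>

lemma ex_triple_product:
  assumes "a \<in> Obj C" "b \<in> Obj C" "c \<in> Obj C"
  shows "\<exists>p p1 p2 p3. is_triple_product a b c p p1 p2 p3"
proof -
  obtain d d1 d2 where d: "is_product C a b d d1 d2" using ex_product assms by blast
  then have d': "d \<in> Obj C" "d1 \<in> Hom C d a" "d2 \<in> Hom C d b" unfolding is_product_def by blast+
  have d_ex: "\<exists>u. u \<in> Hom C x d \<and> d1 \<cdot> u = f \<and> d2 \<cdot> u = g"
    if "f \<in> Hom C x a" "g \<in> Hom C x b" for x f g
  proof -
    have "x \<in> Obj C" using that(1) by auto
    then show ?thesis using d that unfolding is_product_def by blast
  qed
  have d_eq: "u = v" if uv: "u \<in> Hom C x d" "v \<in> Hom C x d" "d1 \<cdot> u = d1 \<cdot> v" "d2 \<cdot> u = d2 \<cdot> v" for x u v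
  proof -
    have "x \<in> Obj C" "d1 \<cdot> v \<in> Hom C x a" "d2 \<cdot> v \<in> Hom C x b" using d' uv(2) by auto
    then have "\<exists>!w. w \<in> Hom C x d \<and> d1 \<cdot> w = d1 \<cdot> v \<and> d2 \<cdot> w = d2 \<cdot> v"
      using d unfolding is_product_def by blast
    then show ?thesis using uv by metis
  qed
  obtain p q q3 where p: "is_product C d c p q q3" using ex_product d'(1) assms(3) by blast
  then have p': "p \<in> Obj C" "q \<in> Hom C p d" "q3 \<in> Hom C p c" unfolding is_product_def by blast+
  have p_ex: "\<exists>u. u \<in> Hom C x p \<and> q \<cdot> u = f \<and> q3 \<cdot> u = g"
    if "f \<in> Hom C x d" "g \<in> Hom C x c" for x f g
  proof -
    have "x \<in> Obj C" using that(1) by auto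
    then show ?thesis using p that unfolding is_product_def by blast
  qed
  have p_eq: "u = v" if uv: "u \<in> Hom C x p" "v \<in> Hom C x p" "q \<cdot> u = q \<cdot> v" "q3 \<cdot> u = q3 \<cdot> v" for x u v
  proof -
    have "x \<in> Obj C" "q \<cdot> v \<in> Hom C x d" "q3 \<cdot> v \<in> Hom C x c" using p' uv(2) by auto
    then have "\<exists>!w. w \<in> Hom C x p \<and> q \<cdot> w = q \<cdot> v \<and> q3 \<cdot> w = q3 \<cdot> v"
      using p unfolding is_product_def by blast
    then show ?thesis using uv by metis
  qed
  have comp: "(d1 \<cdot> q) \<cdot> u = d1 \<cdot> (q \<cdot> u)" "(d2 \<cdot> q) \<cdot> u = d2 \<cdot> (q \<cdot> u)"
    "q \<cdot> u \<in> Hom C x d" if "u \<in> Hom C x p" for x u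
    using d' p' that by simp_all
  show ?thesis
    unfolding is_triple_product_def
  proof (rule exI[of _ p], rule exI[of _ "d1 \<cdot> q"], rule exI[of _ "d2 \<cdot> q"], rule exI[of _ q3],
      intro conjI allI ballI impI)
    fix x f g h
    assume "f \<in> Hom C x a" "g \<in> Hom C x b" "h \<in> Hom C x c"
    then show "\<exists>u. u \<in> Hom C x p \<and> d1 \<cdot> q \<cdot> u = f \<and> d2 \<cdot> q \<cdot> u = g \<and> q3 \<cdot> u = h"
      using d_ex[of f x g] p_ex comp by metis
  next
    fix x u v
    assume uv: "u \<in> Hom C x p" "v \<in> Hom C x p" "d1 \<cdot> q \<cdot> u = d1 \<cdot> q \<cdot> v" "d2 \<cdot> q \<cdot> u = d2 \<cdot> q \<cdot> v" "q3 \<cdot> u = q3 \<cdot> v"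
    have "q \<cdot> u = q \<cdot> v"
      by (rule d_eq[OF comp(3)[OF uv(1)] comp(3)[OF uv(2)]])
        (use uv(3,4) in \<open>simp_all only: comp(1,2)[OF uv(1)] comp(1,2)[OF uv(2)]\<close>)
    then show "u = v" using p_eq uv by metis
  qed (use d' p' in simp_all)
qed

text \<open>The products and the differential enter as parameters constrained only by their
  projections, so the chase never depends on how they were built. \<open>ex_homotopy_square\<close>
  supplies them.\<close>

context
  fixes a b :: "('o, 'm) chain_map_data" and P :: "int \<Rightarrow> 'o" and pl pm pn D :: "int \<Rightarrow> 'm"
  assumes a: "is_chain_map C a" and b: "is_chain_map C b" and ab: "tgt b = tgt a"
    and triple: "\<And>i. is_triple_product (ob (src a) i) (ob (src b) i) (ob (tgt a) (i - 1)) (P i) (pl i) (pm i) (pn i)"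
    and D: "\<And>i. D i \<in> Hom C (P i) (P (i + 1))"
    and pl_D: "\<And>i. pl (i + 1) \<cdot> D i = diff (src a) i \<cdot> pl i"
    and pm_D: "\<And>i. pm (i + 1) \<cdot> D i = diff (src b) i \<cdot> pm i"
    and pn_D: "\<And>i. pn (i + 1) \<cdot> D i = cmp a i \<cdot> pl i \<oplus> \<ominus> (cmp b i \<cdot> pm i \<oplus> diff (tgt a) (i - 1) \<cdot> pn i)"
begin

lemmas pl = is_triple_productD(1)[OF triple]
  and pm = is_triple_productD(2)[OF triple]
  and pn = is_triple_productD(3)[OF triple]
  and tuple = is_triple_productD(4)[OF triple]
  and tuple_eqI = is_triple_productD(5)[OF triple]

lemma fibre_simps:
  "pl i \<in> Arr C" "Dom C (pl i) = P i" "Cod C (pl i) = ob (src a) i"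
  "pm i \<in> Arr C" "Dom C (pm i) = P i" "Cod C (pm i) = ob (src b) i"
  "pn i \<in> Arr C" "Dom C (pn i) = P i" "Cod C (pn i) = ob (tgt a) (i - 1)"
  "D i \<in> Arr C" "Dom C (D i) = P i" "Cod C (D i) = P (i + 1)" "P i \<in> Obj C"
  using pl[of i] pm[of i] pn[of i] D[of i] Dom_Obj[of "pl i"] by auto

lemmas fibre_simps' = a b ab fibre_simps

text \<open>The differential evaluated on a generalised element \<open>u\<close>, read as the triple
  of its three projections.\<close>

lemma fibre_D_comp:
  assumes "u \<in> Hom C x (P i)" "j = i + 1"
  shows "pl j \<cdot> (D i \<cdot> u) = diff (src a) i \<cdot> (pl i \<cdot> u)"
    "pm j \<cdot> (D i \<cdot> u) = diff (src b) i \<cdot> (pm i \<cdot> u)"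
    "pn j \<cdot> (D i \<cdot> u) = cmp a i \<cdot> (pl i \<cdot> u) \<oplus> \<ominus> (cmp b i \<cdot> (pm i \<cdot> u) \<oplus> diff (tgt a) (i - 1) \<cdot> (pn i \<cdot> u))"
  using Comp_congL[OF pl_D[of i], of u] Comp_congL[OF pm_D[of i], of u] Comp_congL[OF pn_D[of i], of u] assms
  by (simp_all add: fibre_simps')

definition fibre :: "('o, 'm) complex_data" where
  "fibre = \<lparr>ob = P, diff = D\<rparr>"

text \<open>Checked on projections. The first two reduce to \<open>L\<close> and \<open>M\<close>;
  the third is \<open>a d l - b d m - d (a l - b m - d k)\<close>, which vanishes because
  \<open>a\<close> and \<open>b\<close> are chain maps and the differential squares to zero.\<close>

lemma fibre_complex: "is_complex C fibre"
  unfolding is_complex_def fibre_def complex_data.simps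
proof (intro allI conjI)
  fix i
  have DD: "D (i + 1) \<cdot> D i \<in> Hom C (P i) (P (i + 1 + 1))"
    using D[of i] D[of "i + 1"] by (simp del: add.assoc)
  have "D (i + 1) \<cdot> D i = Zero C (P i) (P (i + 1 + 1))"
  proof (rule tuple_eqI[OF DD])
    note D' = D[of i]
    note Dc = fibre_D_comp[OF D' refl]
    let ?u = "diff (tgt a) i \<cdot> (cmp a i \<cdot> pl i)" and ?v = "diff (tgt a) i \<cdot> (cmp b i \<cdot> pm i)"
    show "Zero C (P i) (P (i + 1 + 1)) \<in> Hom C (P i) (P (i + 1 + 1))" by (simp add: fibre_simps)
    show "pl (i + 1 + 1) \<cdot> (D (i + 1) \<cdot> D i) = pl (i + 1 + 1) \<cdot> Zero C (P i) (P (i + 1 + 1))"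
      unfolding Dc pl_D by (simp add: fibre_simps')
    show "pm (i + 1 + 1) \<cdot> (D (i + 1) \<cdot> D i) = pm (i + 1 + 1) \<cdot> Zero C (P i) (P (i + 1 + 1))"
      unfolding Dc pm_D by (simp add: fibre_simps')
    have uv: "?u \<in> Arr C" "?v \<in> Arr C" "Dom C ?u = P i" "Dom C ?v = P i"
      "Cod C ?u = ob (tgt a) (i + 1)" "Cod C ?v = ob (tgt a) (i + 1)"
      by (simp_all add: fibre_simps')
    have A: "cmp a (i + 1) \<cdot> (diff (src a) i \<cdot> pl i) = ?u"
      by (rule chain_map_commute_comp) (simp_all add: fibre_simps')
    have B: "cmp b (i + 1) \<cdot> (diff (src b) i \<cdot> pm i) = ?v"
      unfolding ab[symmetric] by (rule chain_map_commute_comp) (simp_all add: fibre_simps')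
    \<comment> \<open>Commutativity is not among the simp rules, so this rearrangement for the third
      projection is supplied explicitly.\<close>
    have "?v \<oplus> (?u \<oplus> \<ominus> ?v) = ?u"
      using uv by (subst Add_lcomm) simp_all
    then have "pn (i + 1 + 1) \<cdot> (D (i + 1) \<cdot> D i) = Zero C (P i) (ob (tgt a) (i + 1))"
      unfolding Dc pl_D pm_D pn_D A B by (simp add: fibre_simps')
    then show "pn (i + 1 + 1) \<cdot> (D (i + 1) \<cdot> D i) = pn (i + 1 + 1) \<cdot> Zero C (P i) (P (i + 1 + 1))"
      by (simp add: fibre_simps' add.commute)
  qed
  then show "D (i + 1) \<cdot> D i = Zero C (P i) (P (i + 2))" by (simp add: add.commute)
qed (use fibre_simps D in simp_all)

definition fibre_fst :: "('o, 'm) chain_map_data" where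
  "fibre_fst = \<lparr>src = fibre, tgt = src a, cmp = pl\<rparr>"

definition fibre_snd :: "('o, 'm) chain_map_data" where
  "fibre_snd = \<lparr>src = fibre, tgt = src b, cmp = pm\<rparr>"

lemma fibre_sel [simp]:
  "ob fibre = P" "diff fibre = D"
  "src fibre_fst = fibre" "tgt fibre_fst = src a" "cmp fibre_fst = pl"
  "src fibre_snd = fibre" "tgt fibre_snd = src b" "cmp fibre_snd = pm"
  by (simp_all add: fibre_def fibre_fst_def fibre_snd_def)

lemma fibre_fst_chain_map: "is_chain_map C fibre_fst"
  unfolding is_chain_map_def by (simp add: fibre_complex fibre_simps' pl_D)

lemma fibre_snd_chain_map: "is_chain_map C fibre_snd"
  unfolding is_chain_map_def by (simp add: fibre_complex fibre_simps' pm_D)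

text \<open>In the homotopy identity the term \<open>d k\<close> cancels against the
  \<open>- d k\<close> in the differential of the fibre, leaving \<open>a l - b m\<close>.\<close>

lemma fibre_square: "(chain_comp b fibre_snd, chain_comp a fibre_fst) \<in> homotopy_rel C"
proof (rule homotopy_relI[where k=pn], goal_cases)
  case (6 i)
  let ?d = "diff (tgt a) (i - 1) \<cdot> pn i" and ?u = "cmp a i \<cdot> pl i" and ?v = "cmp b i \<cdot> pm i"
  have arr: "?d \<in> Arr C" "?u \<in> Arr C" "?v \<in> Arr C" "Dom C ?d = P i" "Dom C ?u = P i" "Dom C ?v = P i"
    "Cod C ?d = ob (tgt a) i" "Cod C ?u = ob (tgt a) i" "Cod C ?v = ob (tgt a) i"
    by (simp_all add: fibre_simps')
  have "(?d \<oplus> (?u \<oplus> \<ominus> (?v \<oplus> ?d))) \<oplus> ?v = (?u \<oplus> \<ominus> (?v \<oplus> ?d)) \<oplus> (?v \<oplus> ?d)"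
    using arr by (simp add: Add_comm Add_lcomm)
  also have "\<dots> = ?u \<oplus> (\<ominus> (?v \<oplus> ?d) \<oplus> (?v \<oplus> ?d))"
    using arr by (intro Add_assoc) simp_all
  also have "\<dots> = ?u"
    using arr Add_neg(2)[of "?v \<oplus> ?d"] by (simp del: neg_Add Add_assoc)
  finally show ?case
    by (simp add: ab pn_D del: neg_Add)
qed (use pn in \<open>simp_all add: chain_map_chain_comp fibre_fst_chain_map fibre_snd_chain_map fibre_simps'\<close>)

text \<open>For a cocycle \<open>z\<close> of \<open>L\<close>, the image \<open>a z\<close> is a
  cocycle, so surjectivity of \<open>b\<close> writes it locally as \<open>b m + d e\<close> with
  \<open>m\<close> a cocycle. These are the remaining coordinates of a cocycle of the fibre over
  \<open>z\<close>.\<close>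

lemma fibre_fst_coh_surj:
  assumes surj: "coh_surj b n"
  shows "coh_surj fibre_fst n"
  unfolding coh_surj_def
proof (intro ballI impI, elim conjE)
  fix z assume "z \<in> Arr C" "Cod C z = ob (tgt fibre_fst) n"
    "diff (tgt fibre_fst) n \<cdot> z = Zero C (Dom C z) (ob (tgt fibre_fst) (n + 1))"
  then have z: "z \<in> Arr C" "Cod C z = ob (src a) n" "diff (src a) n \<cdot> z = Zero C (Dom C z) (ob (src a) (n + 1))"
    by simp_all
  have "diff (tgt a) n \<cdot> (cmp a n \<cdot> z) = cmp a (n + 1) \<cdot> (diff (src a) n \<cdot> z)"
    using a z(1,2) by (simp add: chain_map_commute_comp)
  also have "\<dots> = Zero C (Dom C (cmp a n \<cdot> z)) (ob (tgt a) (n + 1))"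
    unfolding z(3) using a z(1,2) by simp
  finally have "diff (tgt b) n \<cdot> (cmp a n \<cdot> z) = Zero C (Dom C (cmp a n \<cdot> z)) (ob (tgt b) (n + 1))"
    unfolding ab .
  moreover have "cmp a n \<cdot> z \<in> Arr C" "Cod C (cmp a n \<cdot> z) = ob (tgt b) n" using a z(1,2) ab by simp_all
  ultimately obtain p m e where p: "is_epi C p" "Cod C p = Dom C (cmp a n \<cdot> z)"
    and m: "m \<in> Hom C (Dom C p) (ob (src b) n)" and e: "e \<in> Hom C (Dom C p) (ob (tgt b) (n - 1))"
    and dm: "diff (src b) n \<cdot> m = Zero C (Dom C p) (ob (src b) (n + 1))"
    and eq: "(cmp a n \<cdot> z) \<cdot> p = cmp b n \<cdot> m \<oplus> diff (tgt b) (n - 1) \<cdot> e"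
    using surj unfolding coh_surj_def by blast
  have p': "p \<in> Arr C" "Cod C p = Dom C z" using p a z(1,2) by simp_all
  have zp: "z \<cdot> p \<in> Hom C (Dom C p) (ob (src a) n)" using z(1,2) p' by simp
  \<comment> \<open>The lift is the triple \<open>(z p, m, e)\<close>. The third summand in degree
    \<open>n\<close> has degree \<open>n - 1\<close>, which is where \<open>e\<close> lives.\<close>
  obtain u where u: "u \<in> Hom C (Dom C p) (P n)" "pl n \<cdot> u = z \<cdot> p" "pm n \<cdot> u = m" "pn n \<cdot> u = e"
    using tuple[OF zp m e[unfolded ab]] by blast
  have Du: "D n \<cdot> u \<in> Hom C (Dom C p) (P (n + 1))" using u(1) by (simp add: fibre_simps)
  have "D n \<cdot> u = Zero C (Dom C p) (P (n + 1))"
  proof (rule tuple_eqI[OF Du])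
    note Dc = fibre_D_comp[OF u(1) refl, unfolded u(2-)]
    show "Zero C (Dom C p) (P (n + 1)) \<in> Hom C (Dom C p) (P (n + 1))" using p' by (simp add: fibre_simps)
    have "diff (src a) n \<cdot> (z \<cdot> p) = Zero C (Dom C p) (ob (src a) (n + 1))"
      using Comp_congL[OF z(3), of p] z(1,2) p' a by simp
    then show "pl (n + 1) \<cdot> (D n \<cdot> u) = pl (n + 1) \<cdot> Zero C (Dom C p) (P (n + 1))"
      unfolding Dc using p' by (simp add: fibre_simps')
    show "pm (n + 1) \<cdot> (D n \<cdot> u) = pm (n + 1) \<cdot> Zero C (Dom C p) (P (n + 1))"
      unfolding Dc dm using p' by (simp add: fibre_simps')
    have "cmp a n \<cdot> (z \<cdot> p) = cmp b n \<cdot> m \<oplus> diff (tgt a) (n - 1) \<cdot> e"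
      using eq z(1,2) p' a ab by simp
    then have "pn (n + 1) \<cdot> (D n \<cdot> u) = Zero C (Dom C p) (ob (tgt a) n)"
      unfolding Dc using m e ab a b Add_neg(1)[of "cmp b n \<cdot> m \<oplus> diff (tgt a) (n - 1) \<cdot> e"]
      by (simp del: neg_Add Add_assoc)
    then show "pn (n + 1) \<cdot> (D n \<cdot> u) = pn (n + 1) \<cdot> Zero C (Dom C p) (P (n + 1))"
      using p' by (simp add: fibre_simps')
  qed
  \<comment> \<open>The lift projects exactly to \<open>z p\<close>, so the boundary correction is
    zero.\<close>
  then show "\<exists>p c e. is_epi C p \<and> Cod C p = Dom C z \<and> c \<in> Hom C (Dom C p) (ob (src fibre_fst) n) \<and>
      e \<in> Hom C (Dom C p) (ob (tgt fibre_fst) (n - 1)) \<and>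
      diff (src fibre_fst) n \<cdot> c = Zero C (Dom C p) (ob (src fibre_fst) (n + 1)) \<and>
      z \<cdot> p = cmp fibre_fst n \<cdot> c \<oplus> diff (tgt fibre_fst) (n - 1) \<cdot> e"
    using p(1) p' u(1,2) zp z(1,2) a
    by (intro exI[of _ p] exI[of _ u] exI[of _ "Zero C (Dom C p) (ob (src a) (n - 1))"])
      simp
qed

text \<open>Let \<open>x\<close> be the cocycle \<open>(d l, m, k)\<close>. A preimage of the form
  \<open>(l, ?, ?)\<close> is sought: injectivity of \<open>b\<close> makes \<open>m\<close> the
  boundary of some \<open>m'\<close>, and surjectivity one degree lower repairs the mismatch this
  leaves in the third coordinate.\<close>

lemma fibre_fst_coh_inj:
  assumes surj: "coh_surj b (n - 1)" and inj: "coh_inj b n"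
  shows "coh_inj fibre_fst n"
  unfolding coh_inj_def
proof (intro ballI impI, elim conjE)
  fix x l assume "x \<in> Arr C" "Cod C x = ob (src fibre_fst) n"
    "diff (src fibre_fst) n \<cdot> x = Zero C (Dom C x) (ob (src fibre_fst) (n + 1))"
    "l \<in> Hom C (Dom C x) (ob (tgt fibre_fst) (n - 1))" "cmp fibre_fst n \<cdot> x = diff (tgt fibre_fst) (n - 1) \<cdot> l"
  then have x: "x \<in> Hom C (Dom C x) (P n)" and Dx: "D n \<cdot> x = Zero C (Dom C x) (P (n + 1))"
    and l: "l \<in> Hom C (Dom C x) (ob (src a) (n - 1))" and plx: "pl n \<cdot> x = diff (src a) (n - 1) \<cdot> l"
    by simp_all
  define m k where "m = pm n \<cdot> x" and "k = pn n \<cdot> x"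
  have m: "m \<in> Hom C (Dom C x) (ob (src b) n)" and k: "k \<in> Hom C (Dom C x) (ob (tgt a) (n - 1))"
    using x unfolding m_def k_def by (simp_all add: fibre_simps)
  have dm: "diff (src b) n \<cdot> m = Zero C (Dom C x) (ob (src b) (n + 1))"
    using fibre_D_comp(2)[OF x refl] x unfolding Dx m_def by (simp add: fibre_simps')
  have al: "cmp a n \<cdot> (diff (src a) (n - 1) \<cdot> l) = diff (tgt a) (n - 1) \<cdot> (cmp a (n - 1) \<cdot> l)"
    using a l by (intro chain_map_commute_comp) simp_all
  have "diff (tgt a) (n - 1) \<cdot> (cmp a (n - 1) \<cdot> l) \<oplus> \<ominus> (cmp b n \<cdot> m \<oplus> diff (tgt a) (n - 1) \<cdot> k)
      = Zero C (Dom C x) (ob (tgt a) n)"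
    using fibre_D_comp(3)[OF x refl] x unfolding Dx m_def[symmetric] k_def[symmetric] plx al
    by (simp add: fibre_simps')
  then have al_eq: "diff (tgt a) (n - 1) \<cdot> (cmp a (n - 1) \<cdot> l) = cmp b n \<cdot> m \<oplus> diff (tgt a) (n - 1) \<cdot> k"
    using l m k a b ab by (subst (asm) Add_neg_eq_Zero_iff) simp_all
  \<comment> \<open>Vanishing of the third coordinate of the boundary of \<open>x\<close> says
    \<open>a d l = b m + d k\<close>, which exhibits \<open>b m\<close> as the boundary of
    \<open>a l - k\<close>.\<close>
  have "cmp b n \<cdot> m = diff (tgt b) (n - 1) \<cdot> (cmp a (n - 1) \<cdot> l \<oplus> \<ominus> k)"
  proof -
    have "diff (tgt b) (n - 1) \<cdot> (cmp a (n - 1) \<cdot> l \<oplus> \<ominus> k)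
        = diff (tgt a) (n - 1) \<cdot> (cmp a (n - 1) \<cdot> l) \<oplus> \<ominus> (diff (tgt a) (n - 1) \<cdot> k)"
      using l k a ab by simp
    also have "\<dots> = cmp b n \<cdot> m"
      unfolding al_eq using m k a b ab by simp
    finally show ?thesis ..
  qed
  moreover have "cmp a (n - 1) \<cdot> l \<oplus> \<ominus> k \<in> Hom C (Dom C m) (ob (tgt b) (n - 1))"
    using l m k a ab by simp
  moreover have "m \<in> Arr C" "Cod C m = ob (src b) n" "Dom C m = Dom C x" using m by simp_all
  ultimately obtain p m' where p: "is_epi C p" "Cod C p = Dom C x"
    and m': "m' \<in> Hom C (Dom C p) (ob (src b) (n - 1))" "m \<cdot> p = diff (src b) (n - 1) \<cdot> m'"
    using inj dm unfolding coh_inj_def by metis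
  have p': "p \<in> Arr C" using p by simp
  \<comment> \<open>\<open>y\<close> is the defect of the candidate \<open>(l, m', 0)\<close> in the
    third coordinate. It is a cocycle, so surjectivity in degree \<open>n - 1\<close> writes it as
    \<open>b m2 + d k2\<close> with \<open>m2\<close> a cocycle.\<close>
  define y where "y = cmp a (n - 1) \<cdot> (l \<cdot> p) \<oplus> \<ominus> (cmp b (n - 1) \<cdot> m' \<oplus> k \<cdot> p)"
  have y: "y \<in> Arr C" "Dom C y = Dom C p" "Cod C y = ob (tgt b) (n - 1)"
    unfolding y_def using l k m'(1) p(2) p' a b ab by simp_all
  have bm': "diff (tgt a) (n - 1) \<cdot> (cmp b (n - 1) \<cdot> m') = cmp b n \<cdot> (m \<cdot> p)"
    unfolding m'(2) using chain_map_commute_comp[OF b, of n "n - 1" m'] m'(1) ab by simp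
  have "diff (tgt b) (n - 1) \<cdot> y = (diff (tgt a) (n - 1) \<cdot> (cmp a (n - 1) \<cdot> l)) \<cdot> p
      \<oplus> \<ominus> (cmp b n \<cdot> (m \<cdot> p) \<oplus> diff (tgt a) (n - 1) \<cdot> (k \<cdot> p))"
    unfolding y_def bm'[symmetric] using l k m'(1) p(2) p' a b ab by simp
  also have "\<dots> = (cmp b n \<cdot> (m \<cdot> p) \<oplus> diff (tgt a) (n - 1) \<cdot> (k \<cdot> p))
      \<oplus> \<ominus> (cmp b n \<cdot> (m \<cdot> p) \<oplus> diff (tgt a) (n - 1) \<cdot> (k \<cdot> p))"
    unfolding al_eq using m k p(2) p' a b ab by (simp del: neg_Add)
  also have "\<dots> = Zero C (Dom C y) (ob (tgt b) (n - 1 + 1))"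
    using m k p(2) p' a b ab y by (subst Add_neg) simp_all
  finally obtain p2 m2 k2 where p2: "is_epi C p2" "Cod C p2 = Dom C y"
    and m2: "m2 \<in> Hom C (Dom C p2) (ob (src b) (n - 1))" and k2: "k2 \<in> Hom C (Dom C p2) (ob (tgt b) (n - 1 - 1))"
    and dm2: "diff (src b) (n - 1) \<cdot> m2 = Zero C (Dom C p2) (ob (src b) (n - 1 + 1))"
    and eq: "y \<cdot> p2 = cmp b (n - 1) \<cdot> m2 \<oplus> diff (tgt b) (n - 1 - 1) \<cdot> k2"
    using surj y unfolding coh_surj_def by blast
  have p2': "p2 \<in> Arr C" "Cod C p2 = Dom C p" using p2 y by simp_all
  \<comment> \<open>Adding the cocycle \<open>m2\<close> to \<open>m'\<close> leaves the boundary of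
    the second coordinate unchanged, and together with \<open>k2\<close> it absorbs the
    defect.\<close>
  let ?l = "l \<cdot> (p \<cdot> p2)" and ?m = "m' \<cdot> p2 \<oplus> m2"
  have lm: "?l \<in> Hom C (Dom C p2) (ob (src a) (n - 1))" "?m \<in> Hom C (Dom C p2) (ob (src b) (n - 1))"
    using l p(2) p' p2' m'(1) m2 by simp_all
  obtain w where w: "w \<in> Hom C (Dom C p2) (P (n - 1))" "pl (n - 1) \<cdot> w = ?l" "pm (n - 1) \<cdot> w = ?m" "pn (n - 1) \<cdot> w = k2"
    using tuple[OF lm k2[unfolded ab]] by blast
  have "x \<cdot> (p \<cdot> p2) = D (n - 1) \<cdot> w"
  proof (rule tuple_eqI[where x="Dom C p2" and i=n])
    show "x \<cdot> (p \<cdot> p2) \<in> Hom C (Dom C p2) (P n)" "D (n - 1) \<cdot> w \<in> Hom C (Dom C p2) (P n)"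
      using x p(2) p' p2' w(1) by (simp_all add: fibre_simps)
    \<comment> \<open>Lets \<open>fibre_D_comp\<close> deliver projections indexed by
      \<open>n\<close> itself.\<close>
    have n: "n = n - 1 + 1" by simp
    note Dc = fibre_D_comp[OF w(1) n, unfolded w(2-)]
    have "pl n \<cdot> (x \<cdot> (p \<cdot> p2)) = (pl n \<cdot> x) \<cdot> (p \<cdot> p2)"
      using x p(2) p' p2' by (simp add: fibre_simps)
    then show "pl n \<cdot> (x \<cdot> (p \<cdot> p2)) = pl n \<cdot> (D (n - 1) \<cdot> w)"
      unfolding Dc plx using l p(2) p' p2' a by simp
    have "pm n \<cdot> (x \<cdot> (p \<cdot> p2)) = (m \<cdot> p) \<cdot> p2"
      unfolding m_def using x p(2) p' p2' by (simp add: fibre_simps)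
    then show "pm n \<cdot> (x \<cdot> (p \<cdot> p2)) = pm n \<cdot> (D (n - 1) \<cdot> w)"
      unfolding Dc m'(2) using m'(1) m2 dm2 p2' b by simp
    let ?a = "cmp a (n - 1) \<cdot> ?l" and ?c = "cmp b (n - 1) \<cdot> (m' \<cdot> p2)" and ?d = "cmp b (n - 1) \<cdot> m2"
      and ?e = "diff (tgt a) (n - 1 - 1) \<cdot> k2" and ?k = "k \<cdot> (p \<cdot> p2)"
    have arr: "?a \<in> Arr C" "?c \<in> Arr C" "?d \<in> Arr C" "?e \<in> Arr C" "?k \<in> Arr C"
      "Dom C ?a = Dom C p2" "Dom C ?c = Dom C p2" "Dom C ?d = Dom C p2" "Dom C ?e = Dom C p2" "Dom C ?k = Dom C p2"
      "Cod C ?a = ob (tgt a) (n - 1)" "Cod C ?c = ob (tgt a) (n - 1)" "Cod C ?d = ob (tgt a) (n - 1)"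
      "Cod C ?e = ob (tgt a) (n - 1)" "Cod C ?k = ob (tgt a) (n - 1)"
      using lm k p(2) p' p2' m'(1) m2 k2 a b ab by simp_all
    have "?a \<oplus> \<ominus> (?c \<oplus> ?k) = y \<cdot> p2"
      unfolding y_def using l k m'(1) p(2) p' p2' a b ab by simp
    also have "\<dots> = ?d \<oplus> ?e" unfolding eq ab ..
    finally have "?a = (?d \<oplus> ?e) \<oplus> (?c \<oplus> ?k)"
      using arr by (subst (asm) Add_eq_iff[where a="Dom C p2" and b="ob (tgt a) (n - 1)"]) simp_all
    also have "\<dots> = ?k \<oplus> ((?c \<oplus> ?d) \<oplus> ?e)"
      using arr by (simp add: Add_comm Add_lcomm)
    finally have "?a \<oplus> \<ominus> ((?c \<oplus> ?d) \<oplus> ?e) = ?k"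
      using arr by (subst Add_eq_iff[where a="Dom C p2" and b="ob (tgt a) (n - 1)"]) simp_all
    moreover have "pn n \<cdot> (x \<cdot> (p \<cdot> p2)) = ?k"
      unfolding k_def using x p(2) p' p2' by (simp add: fibre_simps)
    moreover have "cmp b (n - 1) \<cdot> ?m = ?c \<oplus> ?d"
      using m'(1) m2 p2' b by simp
    ultimately show "pn n \<cdot> (x \<cdot> (p \<cdot> p2)) = pn n \<cdot> (D (n - 1) \<cdot> w)"
      unfolding Dc by simp
  qed
  moreover have "is_epi C (p \<cdot> p2)" by (rule epi_comp) (use p p2 p2' in simp_all)
  ultimately show "\<exists>p e'. is_epi C p \<and> Cod C p = Dom C x \<and>
      e' \<in> Hom C (Dom C p) (ob (src fibre_fst) (n - 1)) \<and> x \<cdot> p = diff (src fibre_fst) (n - 1) \<cdot> e'"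
    using p p' p2' w(1)
    by (intro exI[of _ "p \<cdot> p2"] exI[of _ w]) simp
qed

text \<open>Restated as pure existence, without \<open>fibre_fst\<close> and
  \<open>fibre_snd\<close>, for use once the parameters have been discharged.\<close>

lemma fibre_completes_square:
  "\<exists>c2 c1. is_chain_map C c2 \<and> is_chain_map C c1 \<and> src c1 = src c2 \<and> tgt c2 = src a \<and> tgt c1 = src b \<and>
    (chain_comp b c1, chain_comp a c2) \<in> homotopy_rel C \<and>
    ((\<forall>n. coh_surj b n \<and> coh_inj b n) \<longrightarrow> (\<forall>n. coh_surj c2 n \<and> coh_inj c2 n))"
  using fibre_fst_chain_map fibre_snd_chain_map fibre_square fibre_fst_coh_surj fibre_fst_coh_inj
  by (intro exI[of _ fibre_fst] exI[of _ fibre_snd]) simp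

end

text \<open>Products are chosen degree by degree, and their universal property yields each
  \<open>D i\<close> from its three prescribed projections.\<close>

lemma ex_homotopy_square:
  assumes a: "is_chain_map C a" and b: "is_chain_map C b" and ab: "tgt b = tgt a"
  obtains c2 c1 where "is_chain_map C c2" "is_chain_map C c1" "src c1 = src c2" "tgt c2 = src a" "tgt c1 = src b"
    "(chain_comp b c1, chain_comp a c2) \<in> homotopy_rel C"
    "(\<forall>n. coh_surj b n \<and> coh_inj b n) \<Longrightarrow> (\<forall>n. coh_surj c2 n \<and> coh_inj c2 n)"
proof -
  have "\<exists>p p1 p2 p3. is_triple_product (ob (src a) i) (ob (src b) i) (ob (tgt a) (i - 1)) p p1 p2 p3" for i
    using a b by (intro ex_triple_product) simp_all
  then obtain P pl pm pn where
    T: "is_triple_product (ob (src a) i) (ob (src b) i) (ob (tgt a) (i - 1)) (P i) (pl i) (pm i) (pn i)" for i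
    by metis
  have "\<forall>i. \<exists>u. u \<in> Hom C (P i) (P (i + 1)) \<and> pl (i + 1) \<cdot> u = diff (src a) i \<cdot> pl i \<and>
      pm (i + 1) \<cdot> u = diff (src b) i \<cdot> pm i \<and>
      pn (i + 1) \<cdot> u = cmp a i \<cdot> pl i \<oplus> \<ominus> (cmp b i \<cdot> pm i \<oplus> diff (tgt a) (i - 1) \<cdot> pn i)"
  proof
    fix i
    show "\<exists>u. u \<in> Hom C (P i) (P (i + 1)) \<and> pl (i + 1) \<cdot> u = diff (src a) i \<cdot> pl i \<and>
      pm (i + 1) \<cdot> u = diff (src b) i \<cdot> pm i \<and>
      pn (i + 1) \<cdot> u = cmp a i \<cdot> pl i \<oplus> \<ominus> (cmp b i \<cdot> pm i \<oplus> diff (tgt a) (i - 1) \<cdot> pn i)"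
      using a b ab is_triple_productD(1-3)[OF T[of i]]
      by (intro is_triple_productD(4)[OF T]) simp_all
  qed
  from choice[OF this] obtain D where D: "D i \<in> Hom C (P i) (P (i + 1))"
    "pl (i + 1) \<cdot> D i = diff (src a) i \<cdot> pl i" "pm (i + 1) \<cdot> D i = diff (src b) i \<cdot> pm i"
    "pn (i + 1) \<cdot> D i = cmp a i \<cdot> pl i \<oplus> \<ominus> (cmp b i \<cdot> pm i \<oplus> diff (tgt a) (i - 1) \<cdot> pn i)" for i
    by blast
  show ?thesis
    using fibre_completes_square[OF a b ab T D] that by blast
qed

end

theorem theorem5p0p1:
  fixes \<A> :: "('o, 'm) preadditive_category"
    and L M K' :: "('o, 'm) complex_data"
    and \<alpha> \<beta> :: "('o, 'm) chain_map_data set"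
  assumes "abelian_category \<A>"
    and "L \<in> Obj (homotopy_category \<A>)"
    and "M \<in> Obj (homotopy_category \<A>)"
    and "K' \<in> Obj (homotopy_category \<A>)"
    and "\<alpha> \<in> Hom (homotopy_category \<A>) L K'"
    and "\<beta> \<in> Hom (homotopy_category \<A>) M K'"
    and "quasi_iso \<A> \<beta>"
  shows "\<exists>K \<in> Obj (homotopy_category \<A>).
    \<exists>\<gamma>2 \<in> Hom (homotopy_category \<A>) K L. \<exists>\<gamma>1 \<in> Hom (homotopy_category \<A>) K M.
      quasi_iso \<A> \<gamma>2 \<and>
      \<alpha> \<cdot>\<^bsub>homotopy_category \<A>\<^esub> \<gamma>2 = \<beta> \<cdot>\<^bsub>homotopy_category \<A>\<^esub> \<gamma>1"
proof -
  interpret abelian_category \<A> by fact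
  obtain a where a: "is_chain_map \<A> a" "src a = L" "tgt a = K'" "\<alpha> = homotopy_rel \<A> `` {a}"
    using assms(5) unfolding homotopy_category_Hom_iff by blast
  obtain b where b: "is_chain_map \<A> b" "src b = M" "tgt b = K'" "\<beta> = homotopy_rel \<A> `` {b}"
    using assms(6) unfolding homotopy_category_Hom_iff by blast
  have ab: "tgt b = tgt a" using a(3) b(3) by simp
  obtain c2 c1 where c: "is_chain_map \<A> c2" "is_chain_map \<A> c1" "src c1 = src c2" "tgt c2 = src a" "tgt c1 = src b"
    and sq: "(chain_comp b c1, chain_comp a c2) \<in> homotopy_rel \<A>"
    and qi: "(\<forall>n. coh_surj b n \<and> coh_inj b n) \<Longrightarrow> (\<forall>n. coh_surj c2 n \<and> coh_inj c2 n)"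
    using ex_homotopy_square[OF a(1) b(1) ab] by blast
  let ?g2 = "homotopy_rel \<A> `` {c2}" and ?g1 = "homotopy_rel \<A> `` {c1}"
  have "quasi_iso \<A> ?g2"
    using qi assms(7) unfolding b(4) by (simp add: quasi_iso_class_iff b(1) c(1))
  \<comment> \<open>The homotopy runs from \<open>b c1\<close> to \<open>a c2\<close>, whence the
    symmetric form of the class equality.\<close>
  moreover have "\<alpha> \<cdot>\<^bsub>homotopy_category \<A>\<^esub> ?g2 = \<beta> \<cdot>\<^bsub>homotopy_category \<A>\<^esub> ?g1"
    unfolding a(4) b(4) homotopy_category_Comp[OF c(1) a(1) c(4)[symmetric]]
      homotopy_category_Comp[OF c(2) b(1) c(5)[symmetric]]
    by (rule homotopy_class_eqI[OF sq, symmetric])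
  moreover have "?g2 \<in> Hom (homotopy_category \<A>) (src c2) L" "?g1 \<in> Hom (homotopy_category \<A>) (src c2) M"
    using a(2) b(2) c unfolding homotopy_category_Hom_iff by metis+
  moreover have "src c2 \<in> Obj (homotopy_category \<A>)"
    using c(1) by (simp add: homotopy_category_def complex_category_def)
  ultimately show ?thesis by blast
qed

end
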